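(* For a tower type $\mathfrak T=(n_1,\dots,n_t)$ of degree $n$, the flag type $T(\mathfrak T)$ is minimal (among realizable flag types of degree $n$) if and only if $\mathfrak T$ is prime, i.e. all $n_1,\dots,n_t$ are prime.
   Context: Let $[n]=\{0,\dots,n-1\}$. A flag type of degree $n$ is a function $T:[n]\times[n]\to[n]$ such that $T(i,j)=T(j,i)$, $T(i,0)=i$, and $T(i,j)\le T(i+1,j)$ for $i<n-1$. A flag of a finite abelian group $G$ of order $n$ (written multiplicatively) is a chain of subsets $\{1\}=F_0\subset\cdots\subset F_{n-1}=G$ with $|F_i|=i+1$; a flag of a degree $n$ field extension $L/K$ is a chain of $K$-subspaces $K=F_0\subset\cdots\subset F_{n-1}=L$ with $\dim_KF_i=i+1$. The flag type of a flag is $T_{\mathcal F}(i,j)=\min\{k: F_iF_j\subseteq F_k\}$, where $F_iF_j$ is the set of products (groups) or the $K$-span of products (fields). A flag type is realizable if it equals $T_{\mathcal F}$ for some flag of a finite abelian group or of a finite field extension. Flag types are partially ordered by $T\le T'$ iff $T(i,j)\le T'(i,j)$ for all $i,j$; a flag type is minimal if it is realizable and minimal among realizable flag types of its degree. A tower type of degree $n$ is a tuple $(n_1,\dots,n_t)$ of integers $>1$ with product $n$. Writing $i\in[n]$ in mixed radix notation $i=i_1+i_2n_1+\cdots+i_tn_1\cdots n_{t-1}$ ($0\le i_s<n_s$), let $H=C_{n_1}\times\cdots\times C_{n_t}$, $e_s$ a generator of the $s$-th factor, $v_i=e_1^{i_1}\cdots e_t^{i_t}$, $F_i=\{v_0,\dots,v_i\}$;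 $T(\mathfrak T)$ is the flag type of this flag of $H$. *)

theory Defs
  imports
    "HOL-Algebra.Product_Groups"
    "HOL-Algebra.Embedded_Algebras"
    "HOL-Computational_Algebra.Primes"
    "HOL-Library.Infinite_Typeclass"
begin

section \<open>Flag types\<close>

text \<open>
  A function on \<open>[n] \<times> [n]\<close> is represented by a function on all pairs of naturals whose values
  outside \<open>[n] \<times> [n]\<close> are irrelevant: every notion below, including equality and the order,
  only looks at arguments \<open>< n\<close>.  The same holds for flags, which are functions
  \<open>nat \<Rightarrow> 'a set\<close> of which only the values at \<open>i < n\<close> matter.
\<close>

definition is_flag_type :: "nat \<Rightarrow> (nat \<Rightarrow> nat \<Rightarrow> nat) \<Rightarrow> bool" where
  "is_flag_type n T \<longleftrightarrow>
     (\<forall>i<n. \<forall>j<n. T i j < n) \<and>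
     (\<forall>i<n. \<forall>j<n. T i j = T j i) \<and>
     (\<forall>i<n. T i 0 = i) \<and>
     (\<forall>i j. i + 1 < n \<longrightarrow> j < n \<longrightarrow> T i j \<le> T (i + 1) j)"

definition flag_type_eq :: "nat \<Rightarrow> (nat \<Rightarrow> nat \<Rightarrow> nat) \<Rightarrow> (nat \<Rightarrow> nat \<Rightarrow> nat) \<Rightarrow> bool" where
  "flag_type_eq n T T' \<longleftrightarrow> (\<forall>i<n. \<forall>j<n. T i j = T' i j)"

definition flag_type_le :: "nat \<Rightarrow> (nat \<Rightarrow> nat \<Rightarrow> nat) \<Rightarrow> (nat \<Rightarrow> nat \<Rightarrow> nat) \<Rightarrow> bool" where
  "flag_type_le n T T' \<longleftrightarrow> (\<forall>i<n. \<forall>j<n. T i j \<le> T' i j)"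


section \<open>Flags of groups\<close>

definition group_flag :: "nat \<Rightarrow> ('a, 'm) monoid_scheme \<Rightarrow> (nat \<Rightarrow> 'a set) \<Rightarrow> bool" where
  "group_flag n G F \<longleftrightarrow>
     F 0 = {\<one>\<^bsub>G\<^esub>} \<and>
     F (n - 1) = carrier G \<and>
     (\<forall>i. i + 1 < n \<longrightarrow> F i \<subseteq> F (i + 1)) \<and>
     (\<forall>i<n. card (F i) = i + 1)"

definition group_flag_type ::
    "nat \<Rightarrow> ('a, 'm) monoid_scheme \<Rightarrow> (nat \<Rightarrow> 'a set) \<Rightarrow> nat \<Rightarrow> nat \<Rightarrow> nat" where
  "group_flag_type n G F i j = (LEAST k. k < n \<and> F i <#>\<^bsub>G\<^esub> F j \<subseteq> F k)"


section \<open>Flags of field extensions\<close>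

text \<open>
  An extension \<open>L/K\<close> is a field \<open>L\<close> with a subfield \<open>K\<close> of it.  The library predicate
  \<open>ring.dimension L d K V\<close> says that \<open>V\<close> is a \<open>K\<close>-subspace of \<open>L\<close> of dimension \<open>d\<close>.
\<close>

definition field_flag :: "nat \<Rightarrow> ('a, 'm) ring_scheme \<Rightarrow> 'a set \<Rightarrow> (nat \<Rightarrow> 'a set) \<Rightarrow> bool" where
  "field_flag n L K F \<longleftrightarrow>
     F 0 = K \<and>
     F (n - 1) = carrier L \<and>
     (\<forall>i. i + 1 < n \<longrightarrow> F i \<subseteq> F (i + 1)) \<and>
     (\<forall>i<n. ring.dimension L (i + 1) K (F i))"

text \<open>The library's \<open>ring.Span\<close> is the set of linear combinations of a list of vectors.\<close>

definition span_of :: "('a, 'm) ring_scheme \<Rightarrow> 'a set \<Rightarrow> 'a set \<Rightarrow> 'a set" where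
  "span_of L K S = (\<Union>Us\<in>{Us. set Us \<subseteq> S}. ring.Span L K Us)"

definition field_flag_type ::
    "nat \<Rightarrow> ('a, 'm) ring_scheme \<Rightarrow> 'a set \<Rightarrow> (nat \<Rightarrow> 'a set) \<Rightarrow> nat \<Rightarrow> nat \<Rightarrow> nat" where
  "field_flag_type n L K F i j = (LEAST k. k < n \<and> span_of L K (F i <#>\<^bsub>L\<^esub> F j) \<subseteq> F k)"


section \<open>Realizable and minimal flag types\<close>

text \<open>
  HOL has no quantification over types inside a formula, so groups and fields range over all
  structures with carrier contained in an infinite type \<open>'u\<close>, passed as a type argument; a
  theorem with \<open>'u\<close> as a type variable speaks about every such universe.  Every group and every field has
  an isomorphic copy in some infinite type, and an infinite type contains a copy of every finite
  group.
\<close>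

definition group_realizable :: "'u::infinite itself \<Rightarrow> nat \<Rightarrow> (nat \<Rightarrow> nat \<Rightarrow> nat) \<Rightarrow> bool" where
  "group_realizable _ n T \<longleftrightarrow>
     (\<exists>(G :: 'u monoid) F.
        comm_group G \<and> finite (carrier G) \<and> order G = n \<and>
        group_flag n G F \<and> flag_type_eq n T (group_flag_type n G F))"

definition field_realizable :: "'u::infinite itself \<Rightarrow> nat \<Rightarrow> (nat \<Rightarrow> nat \<Rightarrow> nat) \<Rightarrow> bool" where
  "field_realizable _ n T \<longleftrightarrow>
     (\<exists>(L :: 'u ring) K F.
        field L \<and> subfield K L \<and> ring.dimension L n K (carrier L) \<and>
        field_flag n L K F \<and> flag_type_eq n T (field_flag_type n L K F))"

definition realizable :: "'u::infinite itself \<Rightarrow> nat \<Rightarrow> (nat \<Rightarrow> nat \<Rightarrow> nat) \<Rightarrow> bool" where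
  "realizable U n T \<longleftrightarrow>
     is_flag_type n T \<and> (group_realizable U n T \<or> field_realizable U n T)"

definition minimal_flag_type :: "'u::infinite itself \<Rightarrow> nat \<Rightarrow> (nat \<Rightarrow> nat \<Rightarrow> nat) \<Rightarrow> bool" where
  "minimal_flag_type U n T \<longleftrightarrow>
     realizable U n T \<and>
     (\<forall>T'. realizable U n T' \<longrightarrow> flag_type_le n T' T \<longrightarrow> flag_type_eq n T' T)"


section \<open>Tower types\<close>

text \<open>
  A tuple is a list; indices are shifted to start at 0.  The empty tuple is the tower type of
  degree 1.
\<close>

definition tower_type :: "nat \<Rightarrow> nat list \<Rightarrow> bool" where
  "tower_type n ns \<longleftrightarrow> (\<forall>m\<in>set ns. m > 1) \<and> prod_list ns = n"

definition prime_tower :: "nat list \<Rightarrow> bool" where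
  "prime_tower ns \<longleftrightarrow> (\<forall>m\<in>set ns. Factorial_Ring.prime m)"

definition tower_group :: "nat list \<Rightarrow> (nat \<Rightarrow> int) monoid" where
  "tower_group ns = product_group {..<length ns} (\<lambda>s. integer_mod_group (ns ! s))"

text \<open>
  The generator of the \<open>s\<close>-th factor is the residue class of 1; note that the operation of
  \<open>integer_mod_group\<close> is addition, with neutral element 0.
\<close>

definition tower_gen :: "nat list \<Rightarrow> nat \<Rightarrow> nat \<Rightarrow> int" where
  "tower_gen ns s = (\<lambda>r\<in>{..<length ns}. if r = s then 1 else 0)"

text \<open>
  The unique digits \<open>0 \<le> i\<^sub>s < n\<^sub>s\<close> with
  \<open>i = i\<^sub>0 + i\<^sub>1 n\<^sub>0 + i\<^sub>2 n\<^sub>0 n\<^sub>1 + \<dots>\<close>, for \<open>i < prod_list ns\<close>.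
\<close>

definition digit :: "nat list \<Rightarrow> nat \<Rightarrow> nat \<Rightarrow> nat" where
  "digit ns i s = (i div prod_list (take s ns)) mod (ns ! s)"

definition tower_elt :: "nat list \<Rightarrow> nat \<Rightarrow> nat \<Rightarrow> int" where
  "tower_elt ns i =
     finprod (tower_group ns)
       (\<lambda>s. tower_gen ns s [^]\<^bsub>tower_group ns\<^esub> digit ns i s) {..<length ns}"

definition tower_flag :: "nat list \<Rightarrow> nat \<Rightarrow> (nat \<Rightarrow> int) set" where
  "tower_flag ns i = tower_elt ns ` {..i}"

definition tower_flag_type :: "nat list \<Rightarrow> nat \<Rightarrow> nat \<Rightarrow> nat" where
  "tower_flag_type ns = group_flag_type (prod_list ns) (tower_group ns) (tower_flag ns)"

end

(*
  In a flag type below T(n_1, ..., n_t), T'(i,j) <= i + j, so F_i F_j lies in F_(i+j), and the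
  members F_(N_s - 1) with N_s = n_1 ... n_s are closed under products, so they are subgroups
  (subfields).  Choose theta_s in F_(N_s) outside F_(N_s - 1) and let w_i be the product of the
  powers theta_s ^ i_s over the mixed radix digits i_s of i; then w_i lies in F_i.  If every n_s is
  prime, each theta_s generates the next subgroup (subfield) over the previous one, so the w_i
  enumerate the group (span the field), and w_i lies in no F_k with k < i.  Since
  w_i w_j = w_(i+j) whenever i + j needs no carry, and T(n_1, ..., n_t) is the largest carry-free sum
  of indices below i and j, the flag type T' is also at least T(n_1, ..., n_t).  Conversely,
  splitting a composite n_s = a b into a, b makes fewer sums carry-free and strictly lowers the type.
*)

theory Submission
  imports
    Defs
    "HOL-Algebra.Multiplicative_Group"
    "HOL-Algebra.Weak_Morphisms"
    "HOL-Algebra.Finite_Extensions"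
begin

section \<open>Mixed radix addition without carries\<close>

text \<open>The head of the list is the least significant place. What remains of \<open>i\<close>
  and \<open>j\<close> beyond the last radix is ignored.\<close>

fun no_carry :: "nat list \<Rightarrow> nat \<Rightarrow> nat \<Rightarrow> bool" where
  "no_carry [] i j \<longleftrightarrow> True"
| "no_carry (m # ns) i j \<longleftrightarrow> i mod m + j mod m < m \<and> no_carry ns (i div m) (j div m)"

text \<open>Addition in the product of cyclic groups, read on indices: carries are dropped instead
  of passed on.\<close>

fun digit_sum :: "nat list \<Rightarrow> nat \<Rightarrow> nat \<Rightarrow> nat" where
  "digit_sum [] i j = 0"
| "digit_sum (m # ns) i j = (i mod m + j mod m) mod m + m * digit_sum ns (i div m) (j div m)"

lemma no_carry_commute: "no_carry ns i j \<longleftrightarrow> no_carry ns j i"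
  by (induction ns arbitrary: i j) (auto simp: add.commute)

lemma no_carry_0_right: "0 \<notin> set ns \<Longrightarrow> no_carry ns i 0"
  by (induction ns arbitrary: i) auto

lemma prod_list_pos: "0 \<notin> set ns \<Longrightarrow> 0 < prod_list (ns :: nat list)"
  by (induction ns) auto

lemma mod_plus_mult_less:
  fixes m r q k :: nat
  assumes "r < m" "q < k"
  shows "r + m * q < m * k"
proof -
  have "r + m * q < m * Suc q" using assms by simp
  also have "\<dots> \<le> m * k" using assms by (intro mult_le_mono2) simp
  finally show ?thesis .
qed

lemma div_less_prod_list: "i < m * k \<Longrightarrow> i div m < (k :: nat)"
  by (simp add: less_mult_imp_div_less mult.commute)

text \<open>Both numbers have only zero digits at the places of \<open>vs\<close>, and no carry
  leaves the top place of \<open>us\<close>. Blocks of indices below a partial product are therefore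
  closed under carry-free addition, which is the source of the subgroups and subfields inside a
  flag.\<close>

lemma no_carry_imp_less:
  assumes "no_carry (us @ vs) i j" "i < prod_list us" "j < prod_list us"
  shows "i + j < prod_list us"
  using assms
proof (induction us arbitrary: i j)
  case (Cons m us)
  have "i div m + j div m < prod_list us"
    using Cons by (auto simp: div_less_prod_list)
  with Cons.prems have "(i mod m + j mod m) + m * (i div m + j div m) < m * prod_list us"
    by (intro mod_plus_mult_less) auto
  also have "(i mod m + j mod m) + m * (i div m + j div m) = i + j"
    by (metis add.assoc add.left_commute add_mult_distrib2 mod_mult_div_eq)
  finally show ?case by simp
qed auto

lemma digit_sum_less: "0 \<notin> set ns \<Longrightarrow> digit_sum ns i j < prod_list ns"
  by (induction ns arbitrary: i j) (auto intro!: mod_plus_mult_less)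

lemma digit_sum_no_carry:
  assumes "no_carry ns i j" "i < prod_list ns" "j < prod_list ns"
  shows "digit_sum ns i j = i + j"
  using assms
proof (induction ns arbitrary: i j)
  case (Cons m ns)
  then have "digit_sum (m # ns) i j = (i mod m + j mod m) + m * (i div m + j div m)"
    by (simp add: div_less_prod_list)
  also have "\<dots> = i + j"
    by (metis add.assoc add.left_commute add_mult_distrib2 mod_mult_div_eq)
  finally show ?case .
qed auto

text \<open>A digit sum with a carry in some place is at most the sum obtained after lowering one of the
  two digits so that they add up to the largest digit.\<close>

lemma digit_sum_le_no_carry:
  assumes "0 \<notin> set ns"
  shows "\<exists>i'\<le>i. \<exists>j'\<le>j. no_carry ns i' j' \<and> digit_sum ns i j \<le> i' + j'"
  using assms
proof (induction ns arbitrary: i j)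
  case (Cons m ns)
  then have m: "0 < m" by simp
  from Cons.prems have "0 \<notin> set ns" by simp
  from Cons.IH[OF this, of "i div m" "j div m"] obtain i1 j1 where 1: "i1 \<le> i div m" "j1 \<le> j div m" "no_carry ns i1 j1"
    "digit_sum ns (i div m) (j div m) \<le> i1 + j1" by blast
  obtain a where a: "a \<le> i mod m" "a + j mod m < m" "(i mod m + j mod m) mod m \<le> a + j mod m"
  proof (cases "i mod m + j mod m < m")
    case True
    then show ?thesis by (intro that[of "i mod m"]) auto
  next
    case False
    moreover have "j mod m < m" "(i mod m + j mod m) mod m < m" using m by auto
    ultimately show ?thesis by (intro that[of "m - 1 - j mod m"]) linarith+
  qed
  have "no_carry (m # ns) (a + m * i1) (j mod m + m * j1)"
    using a 1 m by simp
  moreover have "a + m * i1 \<le> i mod m + m * (i div m)" "j mod m + m * j1 \<le> j mod m + m * (j div m)"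
    by (rule add_mono[OF a(1) mult_le_mono2[OF 1(1)]], rule add_mono[OF order_refl mult_le_mono2[OF 1(2)]])
  moreover have "digit_sum (m # ns) i j \<le> (a + m * i1) + (j mod m + m * j1)"
    using a(3) mult_le_mono2[OF 1(4), of m] by (simp add: algebra_simps)
  ultimately show ?case by (metis mod_mult_div_eq)
qed auto

text \<open>A digit in base \<open>a * b\<close> consists of a low digit in base \<open>a\<close>
  and a high one in base \<open>b\<close>; if neither place carries, the combined sum stays below
  \<open>a * b\<close>.\<close>

lemma no_carry_refine:
  assumes "0 < a" "0 < b" "no_carry (us @ a # b # vs) i j"
  shows "no_carry (us @ a * b # vs) i j"
  using assms(3)
proof (induction us arbitrary: i j)
  case Nil
  have "(i mod a + j mod a) + a * (i div a mod b + j div a mod b) < a * b"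
    using Nil by (intro mod_plus_mult_less) auto
  then show ?case
    using Nil by (simp add: mod_mult2_eq div_mult2_eq algebra_simps)
qed auto

section \<open>Digits of digit sums\<close>

lemma digit_Cons_0: "digit (m # ns) i 0 = i mod m"
  by (simp add: digit_def)

lemma digit_Cons_Suc: "digit (m # ns) i (Suc s) = digit ns (i div m) s"
  by (simp add: digit_def div_mult2_eq)

text \<open>Links the recursion to the closed formula of \<open>digit\<close>, so that products of
  tower elements can be computed on indices.\<close>

lemma digit_digit_sum:
  assumes "0 \<notin> set ns" "s < length ns"
  shows "digit ns (digit_sum ns i j) s = (digit ns i s + digit ns j s) mod (ns ! s)"
  using assms
proof (induction ns arbitrary: i j s)
  case (Cons m ns)
  then show ?case
    by (cases s) (auto simp: digit_Cons_0 digit_Cons_Suc)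
qed auto

lemma digits_inj:
  assumes "i < prod_list ns" "j < prod_list ns" "\<And>s. s < length ns \<Longrightarrow> digit ns i s = digit ns j s"
  shows "i = j"
  using assms
proof (induction ns arbitrary: i j)
  case (Cons m ns)
  have "i div m = j div m"
  proof (rule Cons.IH)
    show "digit ns (i div m) s = digit ns (j div m) s" if "s < length ns" for s
      using Cons.prems(3)[of "Suc s"] that by (simp add: digit_Cons_Suc)
  qed (use Cons.prems(1,2) in \<open>auto simp: div_less_prod_list\<close>)
  moreover have "i mod m = j mod m"
    using Cons.prems(3)[of 0] by (simp add: digit_Cons_0)
  ultimately show ?case by (metis mod_mult_div_eq)
qed auto

section \<open>The flag type of a tower\<close>

lemma chain_mono:
  assumes "\<forall>i. i + 1 < n \<longrightarrow> F i \<subseteq> F (i + 1)" "i \<le> j" "j < (n::nat)"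
  shows "F i \<subseteq> F j"
  using assms(2,3)
proof (induction j rule: dec_induct)
  case (step j)
  then show ?case using assms(1) by auto
qed auto

text \<open>In an increasing chain the indices of the members containing \<open>S\<close> are upward
  closed, so a bound on the least one is an inclusion. Containment in the last member guarantees
  that some index qualifies.\<close>

lemma Least_chain_le_iff:
  assumes "\<forall>i. i + 1 < n \<longrightarrow> F i \<subseteq> F (i + 1)" "S \<subseteq> F (n - 1)" "k < (n::nat)"
  shows "(LEAST k. k < n \<and> S \<subseteq> F k) \<le> k \<longleftrightarrow> S \<subseteq> F k"
proof
  have "n - 1 < n \<and> S \<subseteq> F (n - 1)" using assms by auto
  then have *: "(LEAST k. k < n \<and> S \<subseteq> F k) < n \<and> S \<subseteq> F (LEAST k. k < n \<and> S \<subseteq> F k)"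
    by (rule LeastI)
  assume "(LEAST k. k < n \<and> S \<subseteq> F k) \<le> k"
  with * chain_mono[OF assms(1) _ assms(3)] show "S \<subseteq> F k" by blast
qed (auto intro: Least_le simp: assms)

lemma group_flag_type_le_iff:
  assumes "group G" "group_flag n G F" "i < n" "j < n" "k < n"
  shows "group_flag_type n G F i j \<le> k \<longleftrightarrow> F i <#>\<^bsub>G\<^esub> F j \<subseteq> F k"
proof -
  interpret group G by fact
  have F: "\<forall>i. i + 1 < n \<longrightarrow> F i \<subseteq> F (i + 1)" "F (n - 1) = carrier G"
    using assms(2) by (auto simp: group_flag_def)
  then have "F i \<subseteq> carrier G" "F j \<subseteq> carrier G"
    using chain_mono[OF F(1), of i "n - 1"] chain_mono[OF F(1), of j "n - 1"] assms(3,4) by auto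
  then have "F i <#>\<^bsub>G\<^esub> F j \<subseteq> F (n - 1)"
    using set_mult_closed F(2) by simp
  then show ?thesis
    unfolding group_flag_type_def using assms F by (intro Least_chain_le_iff) auto
qed

lemma group_flag_type_less:
  assumes "group G" "group_flag n G F" "i < n" "j < n"
  shows "group_flag_type n G F i j < n"
proof -
  interpret group G by fact
  have F: "\<forall>i. i + 1 < n \<longrightarrow> F i \<subseteq> F (i + 1)" "F (n - 1) = carrier G"
    using assms(2) by (auto simp: group_flag_def)
  then have "F i \<subseteq> carrier G" "F j \<subseteq> carrier G"
    using chain_mono[OF F(1), of i "n - 1"] chain_mono[OF F(1), of j "n - 1"] assms(3,4) by auto
  then have "F i <#>\<^bsub>G\<^esub> F j \<subseteq> F (n - 1)"
    using set_mult_closed F(2) by simp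
  then have "group_flag_type n G F i j \<le> n - 1"
    using assms by (subst group_flag_type_le_iff) auto
  with assms show ?thesis by simp
qed

section \<open>The tower group in coordinates\<close>

lemma comm_group_product_group:
  assumes "\<And>i. i \<in> I \<Longrightarrow> comm_group (G i)"
  shows "comm_group (product_group I G)"
proof (rule group.group_comm_groupI)
  show "group (product_group I G)"
    using assms by (intro product_group) (auto simp: comm_group_def)
  fix x y assume "x \<in> carrier (product_group I G)" "y \<in> carrier (product_group I G)"
  then show "x \<otimes>\<^bsub>product_group I G\<^esub> y = y \<otimes>\<^bsub>product_group I G\<^esub> x"
    using assms by (auto simp: comm_group_def PiE_iff intro!: restrict_ext comm_monoid.m_comm)
qed

lemma comm_group_tower: "comm_group (tower_group ns)"
  unfolding tower_group_def by (rule comm_group_product_group) simp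

text \<open>\<open>integer_mod_group 0\<close> is the group of all integers, hence the exclusion of
  zero entries.\<close>

lemma carrier_tower:
  assumes "0 \<notin> set ns"
  shows "carrier (tower_group ns) = (\<Pi>\<^sub>E s\<in>{..<length ns}. {0..<int (ns ! s)})"
  unfolding tower_group_def carrier_product_group
  using assms by (intro PiE_cong) (auto simp: carrier_integer_mod_group in_set_conv_nth)

lemma finite_carrier_tower: "0 \<notin> set ns \<Longrightarrow> finite (carrier (tower_group ns))"
  by (simp add: carrier_tower finite_PiE)

lemma order_tower: "0 \<notin> set ns \<Longrightarrow> order (tower_group ns) = prod_list ns"
  by (simp add: order_def carrier_tower card_PiE prod.list_conv_set_nth atLeast0LessThan)

lemma tower_mult:
  "x \<otimes>\<^bsub>tower_group ns\<^esub> y = (\<lambda>s\<in>{..<length ns}. (x s + y s) mod int (ns ! s))"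
  by (simp add: tower_group_def)

lemma tower_one: "\<one>\<^bsub>tower_group ns\<^esub> = (\<lambda>s\<in>{..<length ns}. 0)"
  by (simp add: tower_group_def)

lemma tower_gen_closed:
  assumes "\<forall>m\<in>set ns. 1 < m"
  shows "tower_gen ns s \<in> carrier (tower_group ns)"
proof -
  have "0 \<notin> set ns" using assms by auto
  moreover have "0 < ns ! r \<and> 1 < ns ! r" if "r < length ns" for r
    using assms nth_mem[OF that] by fastforce
  ultimately show ?thesis by (auto simp: carrier_tower tower_gen_def )
qed

lemma tower_pow:
  fixes d :: nat
  shows "x [^]\<^bsub>tower_group ns\<^esub> d =
    (if d = 0 then (\<lambda>s\<in>{..<length ns}. 0) else (\<lambda>s\<in>{..<length ns}. (int d * x s) mod int (ns ! s)))"
proof (induction d)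
  case 0
  show ?case by (simp add: tower_one)
next
  case (Suc d)
  show ?case
    unfolding nat_pow_Suc tower_mult Suc.IH
    by (rule ext) (auto simp: mod_simps algebra_simps)
qed

lemma tower_elt_eq:
  assumes "\<forall>m\<in>set ns. 1 < m"
  shows "tower_elt ns i = (\<lambda>s\<in>{..<length ns}. int (digit ns i s))"
proof -
  interpret comm_group "tower_group ns" by (rule comm_group_tower)
  let ?f = "\<lambda>s. tower_gen ns s [^]\<^bsub>tower_group ns\<^esub> digit ns i s"
  have cl: "?f s \<in> carrier (tower_group ns)" for s
    using assms by (intro nat_pow_closed tower_gen_closed)
  have digit_less: "digit ns i s < ns ! s" if "s < length ns" for s
    using assms nth_mem[OF that] by (auto simp: digit_def)
  \<comment> \<open>Induction on the number \<open>k\<close> of factors multiplied so far; the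
    coordinates from \<open>k\<close> on are still 0.\<close>
  have "finprod (tower_group ns) ?f {..<k} =
      (\<lambda>s\<in>{..<length ns}. if s < k then int (digit ns i s) else 0)" if "k \<le> length ns" for k
    using that
  proof (induction k)
    case 0
    then show ?case by (simp add: tower_one)
  next
    case (Suc k)
    have "finprod (tower_group ns) ?f {..<Suc k} = ?f k \<otimes>\<^bsub>tower_group ns\<^esub> finprod (tower_group ns) ?f {..<k}"
      using cl by (simp add: lessThan_Suc)
    also have "\<dots> = ?f k \<otimes>\<^bsub>tower_group ns\<^esub> (\<lambda>s\<in>{..<length ns}. if s < k then int (digit ns i s) else 0)"
      by (subst Suc.IH) (use Suc.prems in auto)
    also have "\<dots> = (\<lambda>s\<in>{..<length ns}. if s < Suc k then int (digit ns i s) else 0)"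
      unfolding tower_mult tower_pow using digit_less
      by (auto simp: tower_gen_def mod_simps less_Suc_eq intro!: restrict_ext)
    finally show ?case .
  qed
  from this[of "length ns"] show ?thesis
    unfolding tower_elt_def by (auto intro!: restrict_ext)
qed

lemma tower_elt_mult:
  assumes "\<forall>m\<in>set ns. 1 < m"
  shows "tower_elt ns i \<otimes>\<^bsub>tower_group ns\<^esub> tower_elt ns j = tower_elt ns (digit_sum ns i j)"
proof -
  have "0 \<notin> set ns" using assms by auto
  then show ?thesis
    using assms by (auto simp: tower_mult tower_elt_eq digit_digit_sum of_nat_mod intro!: restrict_ext)
qed

lemma inj_on_tower_elt:
  assumes "\<forall>m\<in>set ns. 1 < m"
  shows "inj_on (tower_elt ns) {..<prod_list ns}"
proof (rule inj_onI)
  fix i j assume ij: "i \<in> {..<prod_list ns}" "j \<in> {..<prod_list ns}" "tower_elt ns i = tower_elt ns j"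
  have "digit ns i s = digit ns j s" if "s < length ns" for s
    using fun_cong[OF ij(3), of s] that by (simp add: tower_elt_eq[OF assms])
  then show "i = j" using ij digits_inj[of i ns j] by auto
qed

lemma tower_flag_group_flag:
  assumes ns: "\<forall>m\<in>set ns. 1 < m" and n: "n = prod_list ns"
  shows "group_flag n (tower_group ns) (tower_flag ns)"
proof -
  interpret comm_group "tower_group ns" by (rule comm_group_tower)
  have 0: "0 \<notin> set ns" using ns by auto
  then have "0 < n" using n prod_list_pos by simp
  have inj: "inj_on (tower_elt ns) {..i}" if "i < n" for i
    using inj_on_tower_elt[OF ns] by (rule inj_on_subset) (use that n in auto)
  have "tower_elt ns i \<in> carrier (tower_group ns)" for i
    unfolding tower_elt_def using tower_gen_closed[OF ns] by (intro finprod_closed) auto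
  \<comment> \<open>The first \<open>n\<close> tower elements are distinct and the group has order
    \<open>n\<close>, so the last member is everything.\<close>
  moreover have "card (tower_elt ns ` {..n - 1}) = card (carrier (tower_group ns))"
    using inj[of "n - 1"] \<open>0 < n\<close> order_tower[OF 0] by (simp add: card_image order_def n)
  ultimately have "tower_elt ns ` {..n - 1} = carrier (tower_group ns)"
    by (intro card_subset_eq finite_carrier_tower 0) auto
  moreover have "tower_elt ns 0 = \<one>\<^bsub>tower_group ns\<^esub>"
    by (simp add: tower_elt_def digit_def)
  ultimately show ?thesis
    unfolding group_flag_def tower_flag_def using card_image[OF inj] by auto
qed

text \<open>The product of two members consists of the tower elements at the digit sums of
  \<open>i' \<le> i\<close> and \<open>j' \<le> j\<close>. By \<open>digit_sum_le_no_carry\<close>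
  the carry-free pairs already account for the largest of these. Phrased with a bound
  \<open>k\<close>, the formula serves for upper and lower estimates alike.\<close>

lemma tower_flag_type_le_iff:
  assumes ns: "\<forall>m\<in>set ns. 1 < m" and n: "n = prod_list ns" and ijk: "i < n" "j < n" "k < n"
  shows "tower_flag_type ns i j \<le> k \<longleftrightarrow> (\<forall>i'\<le>i. \<forall>j'\<le>j. no_carry ns i' j' \<longrightarrow> i' + j' \<le> k)"
proof -
  interpret comm_group "tower_group ns" by (rule comm_group_tower)
  have 0: "0 \<notin> set ns" using ns by auto
  have mem_iff: "tower_elt ns l \<in> tower_flag ns k \<longleftrightarrow> l \<le> k" if "l < n" for l
  proof -
    have "{..k} \<subseteq> {..<prod_list ns}" using ijk n by auto
    then show ?thesis
      using inj_on_image_mem_iff[OF inj_on_tower_elt[OF ns], of l "{..k}"] that n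
      by (simp add: tower_flag_def)
  qed
  have "tower_flag_type ns i j \<le> k \<longleftrightarrow>
      tower_flag ns i <#>\<^bsub>tower_group ns\<^esub> tower_flag ns j \<subseteq> tower_flag ns k"
    unfolding tower_flag_type_def using assms
    by (intro group_flag_type_le_iff tower_flag_group_flag group_axioms) auto
  also have "\<dots> \<longleftrightarrow> (\<forall>i'\<le>i. \<forall>j'\<le>j. tower_elt ns (digit_sum ns i' j') \<in> tower_flag ns k)"
    by (auto simp: tower_flag_def set_mult_def tower_elt_mult[OF ns])
  also have "\<dots> \<longleftrightarrow> (\<forall>i'\<le>i. \<forall>j'\<le>j. digit_sum ns i' j' \<le> k)"
    using digit_sum_less[OF 0] n by (simp add: mem_iff)
  also have "\<dots> \<longleftrightarrow> (\<forall>i'\<le>i. \<forall>j'\<le>j. no_carry ns i' j' \<longrightarrow> i' + j' \<le> k)"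
  proof safe
    fix i' j' assume "\<forall>i'\<le>i. \<forall>j'\<le>j. digit_sum ns i' j' \<le> k" "i' \<le> i" "j' \<le> j" "no_carry ns i' j'"
    then have "digit_sum ns i' j' \<le> k" "digit_sum ns i' j' = i' + j'"
      using ijk n by (auto intro: digit_sum_no_carry)
    then show "i' + j' \<le> k" by simp
  next
    fix i' j' assume "\<forall>i'\<le>i. \<forall>j'\<le>j. no_carry ns i' j' \<longrightarrow> i' + j' \<le> k" "i' \<le> i" "j' \<le> j"
    then show "digit_sum ns i' j' \<le> k"
      using digit_sum_le_no_carry[OF 0, of i' j'] by (meson le_trans)
  qed
  finally show ?thesis .
qed

lemma tower_flag_type_less:
  assumes ns: "\<forall>m\<in>set ns. 1 < m" and n: "n = prod_list ns" and ijk: "i < n" "j < n"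
  shows "tower_flag_type ns i j < n"
  unfolding tower_flag_type_def n[symmetric] using comm_group.axioms(2)[OF comm_group_tower] assms
  by (intro group_flag_type_less tower_flag_group_flag) auto

lemma is_flag_type_tower:
  assumes ns: "\<forall>m\<in>set ns. 1 < m" and n: "n = prod_list ns"
  shows "is_flag_type n (tower_flag_type ns)"
proof -
  have 0: "0 \<notin> set ns" using ns by auto
  note le_iff = tower_flag_type_le_iff[OF ns n]
  note less = tower_flag_type_less[OF ns n]
  have n0: "0 < n" using prod_list_pos[OF 0] n by simp
  \<comment> \<open>With \<open>k\<close> chosen as the value at \<open>(j, i)\<close>,
    \<open>le_iff\<close> says that this value bounds all carry-free sums.\<close>
  have "tower_flag_type ns i j \<le> tower_flag_type ns j i" if "i < n" "j < n" for i j
    using le_iff[OF that(2,1) less[OF that(2,1)]] that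
    by (subst le_iff) (auto simp: less, metis add.commute no_carry_commute)
  then have sym: "tower_flag_type ns i j = tower_flag_type ns j i" if "i < n" "j < n" for i j
    using that by (simp add: antisym)
  have "tower_flag_type ns i 0 = i" if "i < n" for i
  proof (rule antisym)
    show "tower_flag_type ns i 0 \<le> i"
      using that n0 by (subst le_iff) auto
    show "i \<le> tower_flag_type ns i 0"
      using le_iff[OF that n0 less[OF that n0]] no_carry_0_right[OF 0, of i] by force
  qed
  moreover have "tower_flag_type ns i j \<le> tower_flag_type ns (i + 1) j" if "i + 1 < n" "j < n" for i j
    using le_iff[OF that less[OF that]] that by (subst le_iff) (auto simp: less)
  ultimately show ?thesis
    unfolding is_flag_type_def using sym less by blast
qed

section \<open>Flags below a tower\<close>

text \<open>This is the element \<open>w_i\<close>. It is defined over a monoid so that groups and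
  the multiplicative monoid of a field can share it.\<close>

fun digit_prod :: "('a, 'b) monoid_scheme \<Rightarrow> nat list \<Rightarrow> (nat \<Rightarrow> 'a) \<Rightarrow> nat \<Rightarrow> 'a" where
  "digit_prod M [] \<theta> i = \<one>\<^bsub>M\<^esub>"
| "digit_prod M (m # ns) \<theta> i =
     \<theta> 0 [^]\<^bsub>M\<^esub> (i mod m) \<otimes>\<^bsub>M\<^esub> digit_prod M ns (\<lambda>s. \<theta> (Suc s)) (i div m)"

text \<open>\<open>x\<close> has zero digits from place \<open>s\<close> on, and the multiple of the
  partial product has zero digits below place \<open>s\<close>.\<close>

lemma no_carry_block:
  assumes "0 \<notin> set ns" "s \<le> length ns" "x < prod_list (take s ns)"
  shows "no_carry ns x (prod_list (take s ns) * a)"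
  using assms
proof (induction ns arbitrary: s x)
  case (Cons m ns)
  then show ?case
  proof (cases s)
    case (Suc s')
    then have "prod_list (take s (m # ns)) * a = m * (prod_list (take s' ns) * a)" by simp
    with Cons Suc show ?thesis by (auto simp: div_less_prod_list)
  qed (simp add: no_carry_commute[of _ 0] no_carry_0_right)
qed auto

section \<open>Products of powers along mixed radix digits\<close>

context comm_monoid
begin

lemma digit_prod_closed:
  "(\<And>s. s < length ns \<Longrightarrow> \<theta> s \<in> carrier G) \<Longrightarrow> digit_prod G ns \<theta> i \<in> carrier G"
proof (induction ns arbitrary: \<theta> i)
  case (Cons m ns)
  then have "\<theta> 0 \<in> carrier G" "digit_prod G ns (\<lambda>s. \<theta> (Suc s)) (i div m) \<in> carrier G" by auto
  then show ?case by simp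
qed auto

lemma digit_prod_0: "(\<And>s. s < length ns \<Longrightarrow> \<theta> s \<in> carrier G) \<Longrightarrow> digit_prod G ns \<theta> 0 = \<one>"
  by (induction ns arbitrary: \<theta>) auto

text \<open>Without carries the digits of \<open>i + j\<close> are sums of digits, so the exponents
  add in each place.\<close>

lemma digit_prod_add:
  assumes "\<And>s. s < length ns \<Longrightarrow> \<theta> s \<in> carrier G" "no_carry ns i j"
  shows "digit_prod G ns \<theta> (i + j) = digit_prod G ns \<theta> i \<otimes> digit_prod G ns \<theta> j"
  using assms
proof (induction ns arbitrary: \<theta> i j)
  case (Cons m ns)
  have \<theta>: "\<theta> 0 \<in> carrier G" "digit_prod G ns (\<lambda>s. \<theta> (Suc s)) k \<in> carrier G" for k
    using Cons.prems(1) by (auto intro: digit_prod_closed)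
  have "(i + j) mod m = i mod m + j mod m" "(i + j) div m = i div m + j div m"
    using Cons.prems(2) mod_add_eq[of i m j] by (simp_all add: div_add1_eq)
  moreover have "digit_prod G ns (\<lambda>s. \<theta> (Suc s)) (i div m + j div m) =
      digit_prod G ns (\<lambda>s. \<theta> (Suc s)) (i div m) \<otimes> digit_prod G ns (\<lambda>s. \<theta> (Suc s)) (j div m)"
    using Cons.prems by (intro Cons.IH) auto
  ultimately show ?case
    using \<theta> by (simp add: nat_pow_mult[symmetric] m_ac)
qed auto

text \<open>The index has the digit \<open>a\<close> at place \<open>s\<close> and zeros
  elsewhere.\<close>

lemma digit_prod_power:
  assumes "\<And>s. s < length ns \<Longrightarrow> \<theta> s \<in> carrier G" "0 \<notin> set ns" "s < length ns" "a < ns ! s"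
  shows "digit_prod G ns \<theta> (prod_list (take s ns) * a) = \<theta> s [^] a"
  using assms
proof (induction ns arbitrary: \<theta> s)
  case (Cons m ns)
  have \<theta>: "\<theta> 0 \<in> carrier G" "\<And>s. s < length ns \<Longrightarrow> \<theta> (Suc s) \<in> carrier G"
    using Cons.prems(1) by auto
  show ?case
  proof (cases s)
    case 0
    with \<theta> Cons.prems show ?thesis by (simp add: digit_prod_0)
  next
    case (Suc s')
    then have "prod_list (take s (m # ns)) * a = m * (prod_list (take s' ns) * a)" by simp
    moreover have "digit_prod G ns (\<lambda>s. \<theta> (Suc s)) (prod_list (take s' ns) * a) = \<theta> (Suc s') [^] a"
      using Cons.prems Suc \<theta> by (intro Cons.IH) auto
    ultimately show ?thesis using Cons.prems Suc \<theta> by simp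
  qed
qed auto

lemma digit_prod_block:
  assumes "\<And>s. s < length ns \<Longrightarrow> \<theta> s \<in> carrier G" "0 \<notin> set ns" "s < length ns"
    "x < prod_list (take s ns)" "a < ns ! s"
  shows "digit_prod G ns \<theta> (x + prod_list (take s ns) * a) = digit_prod G ns \<theta> x \<otimes> \<theta> s [^] a"
  using assms by (simp add: digit_prod_add no_carry_block digit_prod_power)

end

section \<open>Partial products, and flags whose type lies below that of a tower\<close>

lemma prod_list_take_le:
  assumes "0 \<notin> set ns"
  shows "prod_list (take s ns) \<le> prod_list (ns :: nat list)"
proof -
  have "prod_list (take s ns) * prod_list (drop s ns) = prod_list ns"
    by (metis append_take_drop_id prod_list.append)
  moreover have "0 < prod_list (drop s ns)"
    using assms by (intro prod_list_pos) (meson in_set_dropD)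
  ultimately show ?thesis
    by (metis Suc_leI mult.right_neutral mult_le_mono2 One_nat_def)
qed

lemma prod_list_take_pos: "0 \<notin> set ns \<Longrightarrow> 0 < prod_list (take s (ns :: nat list))"
  by (intro prod_list_pos) (meson in_set_takeD)

text \<open>The common ground of the group and the field case; for a field, the monoid is the
  multiplicative one, zero included. \<open>F_mult\<close> expresses, through products of elements
  alone, that the flag type is at most \<open>tower_flag_type ns\<close>.\<close>

locale flag_below_tower = comm_monoid M for M :: "('a, 'm) monoid_scheme" (structure) +
  fixes n :: nat and ns :: "nat list" and F :: "nat \<Rightarrow> 'a set"
  assumes ns: "\<forall>m\<in>set ns. 1 < m" and n: "n = prod_list ns"
    and one_mem: "\<one> \<in> F 0"
    and F_mono: "\<And>i j. i \<le> j \<Longrightarrow> j < n \<Longrightarrow> F i \<subseteq> F j"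
    and F_carrier: "\<And>i. i < n \<Longrightarrow> F i \<subseteq> carrier M"
    and F_mult: "\<And>i j k x y. i < n \<Longrightarrow> j < n \<Longrightarrow> k < n \<Longrightarrow> tower_flag_type ns i j \<le> k \<Longrightarrow>
      x \<in> F i \<Longrightarrow> y \<in> F j \<Longrightarrow> x \<otimes> y \<in> F k"
begin

lemma zero_notin: "0 \<notin> set ns"
  using ns by auto

lemma block_le: "prod_list (take s ns) \<le> n"
  using prod_list_take_le[OF zero_notin] n by simp

lemma block_less: "prod_list (take s ns) - 1 < n"
  using block_le[of s] prod_list_take_pos[OF zero_notin, of s] by linarith

lemma block_size_less:
  assumes "s < length ns"
  shows "prod_list (take s ns) < n"
proof -
  have "prod_list (take s ns) * 1 < prod_list (take s ns) * ns ! s"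
    using ns assms nth_mem[OF assms] prod_list_take_pos[OF zero_notin, of s] by (intro mult_less_mono2) auto
  also have "\<dots> = prod_list (take (Suc s) ns)"
    using assms by (simp add: take_Suc_conv_app_nth)
  also have "\<dots> \<le> n" by (rule block_le)
  finally show ?thesis by simp
qed

text \<open>Every carry-free sum of indices up to \<open>i\<close> and \<open>j\<close> is at most
  \<open>i + j\<close>, hence so is the tower flag type at \<open>i\<close> and
  \<open>j\<close>.\<close>

lemma F_add:
  assumes "i + j < n" "x \<in> F i" "y \<in> F j"
  shows "x \<otimes> y \<in> F (i + j)"
  using assms by (intro F_mult[of i j]) (auto simp: tower_flag_type_le_iff[OF ns n])

lemma F_pow:
  assumes "c * d < n" "x \<in> F c" "0 < c"
  shows "x [^] d \<in> F (c * d)"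
  using assms(1)
proof (induction d)
  case 0
  then show ?case using one_mem by simp
next
  case (Suc d)
  then have "x [^] d \<in> F (c * d)" by simp
  then have "x [^] d \<otimes> x \<in> F (c * d + c)" using assms Suc by (intro F_add) (auto simp: algebra_simps)
  then show ?case by (simp add: algebra_simps)
qed

text \<open>Carry-free sums of indices below a partial product stay below it. Members are indexed
  from 0, so the one whose size or dimension is the partial product has an index one less.\<close>

lemma block_mult_closed:
  assumes "x \<in> F (prod_list (take s ns) - 1)" "y \<in> F (prod_list (take s ns) - 1)"
  shows "x \<otimes> y \<in> F (prod_list (take s ns) - 1)"
proof (rule F_mult[OF block_less block_less block_less _ assms])
  have pos: "0 < prod_list (take s ns)" by (rule prod_list_take_pos[OF zero_notin])
  show "tower_flag_type ns (prod_list (take s ns) - 1) (prod_list (take s ns) - 1)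
      \<le> prod_list (take s ns) - 1"
    unfolding tower_flag_type_le_iff[OF ns n block_less block_less block_less]
  proof (intro allI impI)
    fix i j assume "i \<le> prod_list (take s ns) - 1" "j \<le> prod_list (take s ns) - 1" "no_carry ns i j"
    moreover from this pos have "i < prod_list (take s ns)" "j < prod_list (take s ns)" by linarith+
    ultimately have "i + j < prod_list (take s ns)"
      by (intro no_carry_imp_less[of "take s ns" "drop s ns"]) auto
    then show "i + j \<le> prod_list (take s ns) - 1" by simp
  qed
qed

text \<open>The factor \<open>c\<close> stands for the product of the radices stripped so far; it is
  what makes the induction on the list possible. The case of interest is
  \<open>c = 1\<close>.\<close>

lemma scaled_digit_prod_mem:
  assumes "\<And>s. s < length ms \<Longrightarrow> \<theta> s \<in> F (c * prod_list (take s ms))"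
    "c * prod_list ms \<le> n" "0 < c" "i < prod_list ms" "0 \<notin> set ms"
  shows "digit_prod M ms \<theta> i \<in> F (c * i)"
  using assms
proof (induction ms arbitrary: \<theta> c i)
  case Nil
  then show ?case using one_mem by simp
next
  case (Cons m ms)
  have i: "c * (i mod m) + (c * m) * (i div m) = c * i"
    by (simp only: mult.assoc add_mult_distrib2[symmetric] mod_mult_div_eq)
  have "c * i < c * prod_list (m # ms)"
    using Cons.prems(3,4) by (intro mult_less_mono2)
  then have less: "c * i < n" using Cons.prems(2) by linarith
  have "\<theta> 0 \<in> F c" using Cons.prems(1)[of 0] by simp
  then have "\<theta> 0 [^] (i mod m) \<in> F (c * (i mod m))"
    by (rule F_pow[rotated]) (use less i Cons.prems(3) in linarith)+
  moreover have "digit_prod M ms (\<lambda>s. \<theta> (Suc s)) (i div m) \<in> F ((c * m) * (i div m))"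
  proof (rule Cons.IH)
    show "\<theta> (Suc s) \<in> F (c * m * prod_list (take s ms))" if "s < length ms" for s
      using Cons.prems(1)[of "Suc s"] that by (simp add: mult.assoc)
  qed (use Cons.prems in \<open>auto simp: div_less_prod_list mult.assoc\<close>)
  ultimately have "\<theta> 0 [^] (i mod m) \<otimes> digit_prod M ms (\<lambda>s. \<theta> (Suc s)) (i div m)
      \<in> F (c * (i mod m) + (c * m) * (i div m))"
    by (rule F_add[rotated]) (use less i in linarith)
  then show ?case unfolding i by simp
qed

context
  fixes \<theta> :: "nat \<Rightarrow> 'a"
  assumes \<theta>: "\<And>s. s < length ns \<Longrightarrow> \<theta> s \<in> F (prod_list (take s ns))"
begin

lemma gens_closed: "s < length ns \<Longrightarrow> \<theta> s \<in> carrier M"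
  using \<theta> F_carrier block_size_less by blast

lemma digit_prod_mem:
  assumes "i < n"
  shows "digit_prod M ns \<theta> i \<in> F i"
  using scaled_digit_prod_mem[of ns \<theta> 1 i] \<theta> assms n zero_notin by simp

text \<open>For a carry-free pair below \<open>i\<close> and \<open>j\<close>, the product of
  \<open>w_i'\<close> and \<open>w_j'\<close> is \<open>w_(i'+j')\<close> and lies in the member at
  \<open>T i j\<close>; \<open>indep\<close> turns this into \<open>i' + j' \<le> T i j\<close>.
  Counting elements or dimensions will supply \<open>indep\<close>.\<close>

lemma tower_flag_type_le:
  assumes indep: "\<And>i k. i < n \<Longrightarrow> k < n \<Longrightarrow> digit_prod M ns \<theta> i \<in> F k \<Longrightarrow> i \<le> k"
    and T: "\<And>i j. i < n \<Longrightarrow> j < n \<Longrightarrow> T i j < n"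
      "\<And>i j x y. i < n \<Longrightarrow> j < n \<Longrightarrow> x \<in> F i \<Longrightarrow> y \<in> F j \<Longrightarrow> x \<otimes> y \<in> F (T i j)"
    and ij: "i < n" "j < n"
  shows "tower_flag_type ns i j \<le> T i j"
  unfolding tower_flag_type_le_iff[OF ns n ij T(1)[OF ij]]
proof (intro allI impI)
  fix i' j' assume *: "i' \<le> i" "j' \<le> j" "no_carry ns i' j'"
  then have "i' + j' < n"
    using no_carry_imp_less[of ns "[]" i' j'] ij n by auto
  moreover have "digit_prod M ns \<theta> i' \<in> F i" "digit_prod M ns \<theta> j' \<in> F j"
    using * ij F_mono digit_prod_mem by (meson in_mono le_less_trans)+
  then have "digit_prod M ns \<theta> (i' + j') \<in> F (T i j)"
    using T(2)[OF ij] * by (simp add: digit_prod_add gens_closed)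
  ultimately show "i' + j' \<le> T i j"
    using indep T(1) ij by blast
qed

end

end

section \<open>Group flags\<close>

text \<open>Multiplication by \<open>a\<close> is injective on the finite set \<open>H\<close>,
  hence onto, so some \<open>b\<close> in \<open>H\<close> satisfies
  \<open>a \<otimes> b = \<one>\<close>.\<close>

lemma (in group) finite_submonoid_subgroup:
  assumes "finite H" "H \<subseteq> carrier G" "\<one> \<in> H" "\<And>x y. x \<in> H \<Longrightarrow> y \<in> H \<Longrightarrow> x \<otimes> y \<in> H"
  shows "subgroup H G"
proof (rule subgroupI)
  fix a assume a: "a \<in> H"
  have "inj_on (\<lambda>x. a \<otimes> x) H" using assms(2) a by (intro inj_onI) (meson Units_l_cancel Units_eq[THEN equalityD2] in_mono)
  moreover have "(\<lambda>x. a \<otimes> x) ` H \<subseteq> H" using assms(4) a by auto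
  ultimately have "(\<lambda>x. a \<otimes> x) ` H = H"
    using assms(1) by (simp add: endo_inj_surj)
  then obtain b where "b \<in> H" "a \<otimes> b = \<one>" using assms(3) by (metis imageE)
  then have "inv b = a" using a assms(2) by (intro inv_equality) auto
  then show "inv a \<in> H" using \<open>b \<in> H\<close> assms(2) by auto
qed (use assms in auto)

text \<open>The quotient by \<open>H\<close> has prime order \<open>p\<close> and the coset of
  \<open>\<theta>\<close> is nontrivial in it, so by Lagrange the powers of that coset exhaust the
  quotient.\<close>

lemma (in comm_group) prime_index_powers:
  assumes H: "subgroup H G" and fin: "finite (carrier G)" and index: "order G = p * card H"
    and p: "Factorial_Ring.prime (p :: nat)" and \<theta>: "\<theta> \<in> carrier G" "\<theta> \<notin> H" and x: "x \<in> carrier G"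
  shows "\<exists>a<p. \<exists>h\<in>H. x = h \<otimes> \<theta> [^] a"
proof -
  interpret H: normal H G using H by (rule subgroup_imp_normal)
  interpret Q: group "G Mod H" by (rule H.factorgroup_is_group)
  have "card H > 0" using H.subset fin H.one_closed by (metis card_gt_0_iff empty_iff rev_finite_subset)
  moreover have "card (rcosets H) * card H = p * card H" using lagrange[OF H] index by simp
  ultimately have orderQ: "order (G Mod H) = p" by (simp add: FactGroup_def order_def)
  have finQ: "finite (carrier (G Mod H))"
    using orderQ p by (metis card.infinite order_def not_prime_0)
  have pow: "(H #> y) [^]\<^bsub>G Mod H\<^esub> (k :: nat) = H #> (y [^] k)" if "y \<in> carrier G" for y k
    using that H.subset by (induction k) (auto simp: FactGroup_def H.rcos_sum coset_mult_one)
  define c where "c = H #> \<theta>"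
  have c: "c \<in> carrier (G Mod H)" using \<theta> by (auto simp: c_def FactGroup_def RCOSETS_def)
  have "c \<noteq> \<one>\<^bsub>G Mod H\<^esub>"
    using rcos_self[OF \<theta>(1) H] \<theta>(2) by (auto simp: c_def)
  then have "Q.ord c \<noteq> 1" using Q.ord_eq_1[OF c] by simp
  moreover have "Q.ord c dvd p" using Q.ord_dvd_group_order[OF c] orderQ by simp
  ultimately have ord: "Q.ord c = p" using p by (metis prime_nat_iff)
  \<comment> \<open>The exponents \<open>0..p - 1\<close> give distinct powers because
    \<open>c\<close> has order \<open>p\<close>; counting then yields the whole quotient.\<close>
  have "(\<lambda>k. c [^]\<^bsub>G Mod H\<^esub> k) ` {0..p - 1} = carrier (G Mod H)"
  proof (rule card_subset_eq[OF finQ])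
    show "card ((\<lambda>k. c [^]\<^bsub>G Mod H\<^esub> k) ` {0..p - 1}) = card (carrier (G Mod H))"
      using Q.ord_inj[OF c] ord orderQ p prime_gt_0_nat[OF p] by (simp add: card_image order_def)
  qed (use c in auto)
  moreover have "H #> x \<in> carrier (G Mod H)" using x by (auto simp: FactGroup_def RCOSETS_def)
  ultimately obtain a where a: "a \<in> {0..p - 1}" "H #> x = c [^]\<^bsub>G Mod H\<^esub> a" by (metis (no_types, lifting) imageE)
  then have "x \<in> H #> (\<theta> [^] a)" using rcos_self[OF x H] pow[OF \<theta>(1)] by (simp add: c_def)
  moreover have "a < p" using a prime_gt_0_nat[OF p] by auto
  ultimately show ?thesis by (auto simp: r_coset_def)
qed

lemma (in comm_group) prime_relative_index_powers:
  assumes H: "subgroup H G" and H': "subgroup H' G" and fin: "finite (carrier G)"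
    and index: "card H' = p * card H"
    and p: "Factorial_Ring.prime (p :: nat)" and \<theta>: "\<theta> \<in> H'" "\<theta> \<notin> H" and "H \<subseteq> H'" and x: "x \<in> H'"
  shows "\<exists>a<p. \<exists>h\<in>H. x = h \<otimes> \<theta> [^] a"
proof -
  interpret K: comm_group "G\<lparr>carrier := H'\<rparr>"
    using H' subgroup.subset[OF H'] m_comm
    by (intro group.group_comm_groupI subgroup_imp_group) auto
  have "subgroup H (G\<lparr>carrier := H'\<rparr>)"
    using subgroup_incl[OF H H'] assms by simp
  moreover have "finite H'" using H' fin by (meson finite_subset subgroup.subset)
  ultimately show ?thesis
    using K.prime_index_powers[of H p \<theta> x] assms by (simp add: order_def nat_pow_consistent[symmetric])
qed

text \<open>The \<open>w_i\<close> enumerate the group, so these \<open>n\<close> elements are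
  distinct; counting the elements of each member then gives the hypothesis \<open>indep\<close> of
  \<open>tower_flag_type_le\<close>.\<close>

lemma tower_le_group_flag_type:
  fixes G :: "('a, 'm) monoid_scheme" (structure)
  assumes G: "comm_group G" and fin: "finite (carrier G)" and order: "order G = n"
    and F: "group_flag n G F" and ns: "prime_tower ns" and n: "n = prod_list ns"
    and le: "flag_type_le n (group_flag_type n G F) (tower_flag_type ns)"
  shows "flag_type_le n (tower_flag_type ns) (group_flag_type n G F)"
proof -
  interpret comm_group G by fact
  have ns1: "\<forall>m\<in>set ns. 1 < m" using ns prime_gt_1_nat by (auto simp: prime_tower_def)
  have chain: "\<forall>i. i + 1 < n \<longrightarrow> F i \<subseteq> F (i + 1)" and top: "F (n - 1) = carrier G"
    and card: "\<And>i. i < n \<Longrightarrow> card (F i) = i + 1" and bot: "F 0 = {\<one>}"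
    using F by (auto simp: group_flag_def)
  have mono: "F i \<subseteq> F j" if "i \<le> j" "j < n" for i j
    using chain_mono[OF chain] that by blast
  have mult_T: "x \<otimes> y \<in> F (group_flag_type n G F i j)" if "i < n" "j < n" "x \<in> F i" "y \<in> F j" for i j x y
    using group_flag_type_le_iff[OF group_axioms F that(1,2) group_flag_type_less[OF group_axioms F that(1,2)]]
      that(3,4) by (auto simp: set_mult_def)
  interpret F: flag_below_tower G n ns F
  proof
    fix i j k x y assume *: "i < n" "j < n" "k < n" "tower_flag_type ns i j \<le> k" "x \<in> F i" "y \<in> F j"
    then have "group_flag_type n G F i j \<le> k" using le by (force simp: flag_type_le_def)
    with mult_T[OF *(1,2,5,6)] mono *(3) show "x \<otimes> y \<in> F k" by blast
  next
    fix i assume "i < n" then show "F i \<subseteq> carrier G" using mono[of i "n - 1"] top by auto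
  qed (use ns1 n bot mono in auto)
  let ?N = "\<lambda>s. prod_list (take s ns)"
  have pos: "0 < ?N s" for s by (rule prod_list_take_pos[OF F.zero_notin])
  \<comment> \<open>Consecutive members differ by exactly one element, the only choice for
    \<open>\<theta> s\<close>.\<close>
  have "\<exists>t. t \<in> F (?N s) \<and> t \<notin> F (?N s - 1)" if "s < length ns" for s
  proof (rule ccontr)
    assume "\<nexists>t. t \<in> F (?N s) \<and> t \<notin> F (?N s - 1)"
    then have "F (?N s) = F (?N s - 1)" using mono[of "?N s - 1" "?N s"] F.block_size_less[OF that] by auto
    then show False using card[OF F.block_size_less[OF that]] card[OF F.block_less[of s]] pos[of s] by simp
  qed
  then obtain \<theta> where \<theta>: "\<And>s. s < length ns \<Longrightarrow> \<theta> s \<in> F (?N s)"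
    and \<theta>': "\<And>s. s < length ns \<Longrightarrow> \<theta> s \<notin> F (?N s - 1)" by metis
  have sub: "subgroup (F (?N s - 1)) G" for s
  proof (rule finite_submonoid_subgroup)
    show "F (?N s - 1) \<subseteq> carrier G" using F.F_carrier F.block_less by blast
    then show "finite (F (?N s - 1))" using fin finite_subset by blast
    show "\<one> \<in> F (?N s - 1)" using bot mono[of 0] F.block_less by blast
  qed (rule F.block_mult_closed)
  \<comment> \<open>Climbing the tower: each stage has prime index \<open>ns ! s\<close> in the
    next, and multiplying by the power \<open>a\<close> of \<open>\<theta> s\<close> shifts the
    index of \<open>w\<close> by \<open>?N s * a\<close>.\<close>
  have enum: "F (?N s - 1) \<subseteq> digit_prod G ns \<theta> ` {..<?N s}" if "s \<le> length ns" for s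
    using that
  proof (induction s)
    case 0
    then show ?case using bot F.gens_closed[OF \<theta>] by (simp add: digit_prod_0)
  next
    case (Suc s)
    then have s: "s < length ns" by simp
    have N: "?N (Suc s) = ns ! s * ?N s" using s by (simp add: take_Suc_conv_app_nth)
    have p: "Factorial_Ring.prime (ns ! s)" using ns s by (simp add: prime_tower_def)
    then have NN: "?N s < ?N (Suc s)" using N pos[of s] prime_gt_1_nat by simp
    have \<theta>s: "\<theta> s \<in> F (?N (Suc s) - 1)"
    proof -
      have "?N s \<le> ?N (Suc s) - 1" using NN by linarith
      then show ?thesis using \<theta>[OF s] mono[OF _ F.block_less] by blast
    qed
    have incl: "F (?N s - 1) \<subseteq> F (?N (Suc s) - 1)"
      by (rule mono[OF _ F.block_less]) (use NN in simp)
    have index: "card (F (?N (Suc s) - 1)) = ns ! s * card (F (?N s - 1))"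
      using card[OF F.block_less[of s]] card[OF F.block_less[of "Suc s"]] pos[of s] pos[of "Suc s"]
      unfolding N by simp
    show ?case
    proof
      fix x assume "x \<in> F (?N (Suc s) - 1)"
      then obtain a h where a: "a < ns ! s" and h: "h \<in> F (?N s - 1)" "x = h \<otimes> \<theta> s [^] a"
        using prime_relative_index_powers[OF sub[of s] sub[of "Suc s"] fin index p \<theta>s \<theta>'[OF s] incl]
        by blast
      then obtain i where i: "i < ?N s" "h = digit_prod G ns \<theta> i" using Suc.IH s by auto
      have "x = digit_prod G ns \<theta> (i + ?N s * a)"
        using h i a s F.gens_closed[OF \<theta>] by (simp add: digit_prod_block F.zero_notin)
      moreover have "i + ?N s * a < ?N (Suc s)"
        unfolding N using mod_plus_mult_less[OF i(1) a] by (simp add: mult.commute)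
      ultimately show "x \<in> digit_prod G ns \<theta> ` {..<?N (Suc s)}" by blast
    qed
  qed
  have "carrier G \<subseteq> digit_prod G ns \<theta> ` {..<n}" using enum[of "length ns"] top n by simp
  \<comment> \<open>\<open>n\<close> indices cover \<open>n\<close> elements, so no two indices give
    the same element.\<close>
  then have "n \<le> card (digit_prod G ns \<theta> ` {..<n})"
    using order by (metis card_mono finite_imageI finite_lessThan order_def)
  then have inj: "inj_on (digit_prod G ns \<theta>) {..<n}"
    by (intro eq_card_imp_inj_on) (auto intro: antisym card_image_le[of "{..<n}", simplified])
  have indep: "i \<le> k" if ik: "i < n" "k < n" "digit_prod G ns \<theta> i \<in> F k" for i k
  proof (rule ccontr)
    assume "\<not> i \<le> k"
    \<comment> \<open>\<open>w_0, ..., w_k\<close> are \<open>k + 1\<close> distinct elements of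
      \<open>F k\<close> and fill it; \<open>w_i\<close> would be one too many.\<close>
    have "digit_prod G ns \<theta> j \<in> F k" if "j \<le> k" for j
      using F.digit_prod_mem[OF \<theta>, of j] mono[OF that] that ik by auto
    moreover have "digit_prod G ns \<theta> i \<notin> digit_prod G ns \<theta> ` {..k}"
      using inj_on_image_mem_iff[OF inj, of i "{..k}"] ik \<open>\<not> i \<le> k\<close> by (auto simp: subset_eq)
    ultimately have "digit_prod G ns \<theta> ` {..k} \<subset> F k"
      using ik(3) by auto
    moreover have "finite (F k)" using F.F_carrier ik fin finite_subset by blast
    ultimately have "card (digit_prod G ns \<theta> ` {..k}) < card (F k)"
      by (intro psubset_card_mono)
    moreover have "card (digit_prod G ns \<theta> ` {..k}) = k + 1"
      using inj_on_subset[OF inj, of "{..k}"] ik by (simp add: card_image subset_eq)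
    ultimately show False using card[OF ik(2)] by simp
  qed
  have "tower_flag_type ns i j \<le> group_flag_type n G F i j" if "i < n" "j < n" for i j
    using F.tower_flag_type_le[of \<theta> "group_flag_type n G F", OF \<theta> indep
        group_flag_type_less[OF group_axioms F] mult_T that] by blast
  then show ?thesis by (simp add: flag_type_le_def)
qed

text \<open>A finite carrier embeds in any infinite type, and the group structure, the flag and its
  type are carried along. This moves \<open>tower_group\<close>, whose elements are functions from
  \<open>nat\<close> to \<open>int\<close>, into the universe \<open>'u\<close>.\<close>

lemma group_realizableI:
  fixes G :: "('a, 'm) monoid_scheme"
  assumes G: "comm_group G" and fin: "finite (carrier G)" and order: "order G = n"
    and F: "group_flag n G F" and T: "flag_type_eq n T (group_flag_type n G F)"
  shows "group_realizable TYPE('u::infinite) n T"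
proof -
  interpret comm_group G by fact
  obtain B :: "'u set" where "finite B" "card B = card (carrier G)"
    using infinite_arbitrarily_large[OF infinite_UNIV] by blast
  then obtain f where "bij_betw f (carrier G) B"
    using finite_same_card_bij[OF fin] by metis
  then have inj: "inj_on f (carrier G)" by (rule bij_betw_imp_inj_on)
  define H where "H = image_group f G"
  have carr: "carrier H = f ` carrier G" by (simp add: H_def image_group_carrier)
  have mult: "f x \<otimes>\<^bsub>H\<^esub> f y = f (x \<otimes>\<^bsub>G\<^esub> y)" if "x \<in> carrier G" "y \<in> carrier G" for x y
    using that inj by (simp add: H_def image_group_def)
  have "f \<in> iso G H"
    using inj mult by (auto simp: iso_def hom_def bij_betw_def carr)
  \<comment> \<open>The transfer rule overwrites the unit by the image of the old one; for
    \<open>image_group\<close> that is the unit already.\<close>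
  then have "comm_group (H\<lparr>one := f \<one>\<^bsub>G\<^esub>\<rparr>)" by (rule iso_imp_img_comm_group)
  then have H: "comm_group H" by (simp add: H_def image_group_def)
  have chain: "\<forall>i. i + 1 < n \<longrightarrow> F i \<subseteq> F (i + 1)" and top: "F (n - 1) = carrier G"
    using F by (auto simp: group_flag_def)
  have FG: "F i \<subseteq> carrier G" if "i < n" for i
    using chain_mono[OF chain, of i "n - 1"] that top by auto
  have flag: "group_flag n H (\<lambda>i. f ` F i)"
    unfolding group_flag_def
  proof (intro conjI allI impI)
    show "f ` F i \<subseteq> f ` F (i + 1)" if "i + 1 < n" for i
      using chain that by (intro image_mono) auto
    show "card (f ` F i) = i + 1" if "i < n" for i
      using F that card_image[OF inj_on_subset[OF inj FG]] by (auto simp: group_flag_def)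
  qed (use F in \<open>simp_all add: group_flag_def carr H_def image_group_one image_group_carrier\<close>)
  have "group_flag_type n H (\<lambda>i. f ` F i) i j = group_flag_type n G F i j" if "i < n" "j < n" for i j
  proof -
    have sub: "F i <#>\<^bsub>G\<^esub> F j \<subseteq> carrier G" using FG that by (intro set_mult_closed)
    have "f ` F i <#>\<^bsub>H\<^esub> f ` F j = f ` (F i <#>\<^bsub>G\<^esub> F j)"
      using FG[OF that(1)] FG[OF that(2)] by (force simp: set_mult_def mult subset_eq)
    moreover have "f ` (F i <#>\<^bsub>G\<^esub> F j) \<subseteq> f ` F k \<longleftrightarrow> F i <#>\<^bsub>G\<^esub> F j \<subseteq> F k" if "k < n" for k
      unfolding image_subset_iff using inj_on_image_mem_iff[OF inj _ FG[OF that]] sub by blast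
    ultimately show ?thesis unfolding group_flag_type_def by (intro arg_cong[where f = Least] ext) auto
  qed
  then have "flag_type_eq n T (group_flag_type n H (\<lambda>i. f ` F i))"
    using T by (simp add: flag_type_eq_def)
  moreover have "finite (carrier H)" "order H = n"
    using fin order inj by (simp_all add: carr order_def card_image)
  ultimately show ?thesis
    unfolding group_realizable_def using H flag by blast
qed

lemma tower_realizable:
  assumes "\<forall>m\<in>set ns. 1 < m" "n = prod_list ns"
  shows "realizable TYPE('u::infinite) n (tower_flag_type ns)"
proof -
  have "0 \<notin> set ns" using assms(1) by auto
  then show ?thesis
    unfolding realizable_def using assms
    by (intro conjI disjI1 is_flag_type_tower group_realizableI[of "tower_group ns" _ "tower_flag ns"])
      (auto simp: comm_group_tower finite_carrier_tower order_tower tower_flag_group_flag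
        flag_type_eq_def tower_flag_type_def)
qed

section \<open>Field flags\<close>

context ring
begin

text \<open>A list spanning \<open>V\<close> over \<open>K\<close> also spans it over
  \<open>E\<close>, because every \<open>E\<close>-subspace containing the list is a
  \<open>K\<close>-subspace.\<close>

lemma finite_dimension_overfield:
  assumes "subfield K R" "subfield E R" "K \<subseteq> E" "finite_dimension K V" "subalgebra E V R"
  shows "finite_dimension E V"
proof -
  from assms(4) obtain m where "dimension m K V" by auto
  then obtain Us where Us: "set Us \<subseteq> carrier R" "Span K Us = V"
    using exists_base[OF assms(1)] by blast
  have "V = Span E Us"
  proof (rule Span_subalgebraI[OF assms(2,5)])
    show "set Us \<subseteq> V" using Span_base_incl[OF assms(1) Us(1)] Us(2) by simp
    fix W assume W: "subalgebra E W R" "set Us \<subseteq> W"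
    then have "subalgebra K W R"
      using assms(3) by (auto simp: subalgebra_def subalgebra_axioms_def)
    then show "V \<subseteq> W" using subalgebra_Span_incl[OF assms(1) _ W(2)] Us(2) by simp
  qed
  then show ?thesis using Span_finite_dimension[OF assms(2) Us(1)] by simp
qed

text \<open>A further vector raises the dimension by one or, if it lies in the span already, not at
  all.\<close>

lemma dimension_Span_le:
  assumes "subfield K R" "set Us \<subseteq> carrier R" "dimension m K (Span K Us)"
  shows "m \<le> length Us"
  using assms(2,3)
proof (induction Us arbitrary: m)
  case Nil
  then have "dimension m K {\<zero>}" by simp
  moreover have "dimension 0 K {\<zero>}" by (rule zero_dim)
  ultimately show ?case using dimension_is_inj[OF assms(1)] by fastforce
next
  case (Cons u Us)
  obtain d where d: "dimension d K (Span K Us)"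
    using Span_finite_dimension[OF assms(1), of Us] Cons.prems by auto
  then have "d \<le> length Us" using Cons by simp
  have "m \<le> Suc d"
  proof (cases "u \<in> Span K Us")
    case True
    then have "Span K (u # Us) = Span K Us"
      using mono_Span_subset[OF assms(1), of "u # Us" Us] mono_Span[OF assms(1), of Us u]
        Span_base_incl[OF assms(1), of Us] Cons.prems by auto
    then have "m = d" using d Cons.prems(2) dimension_is_inj[OF assms(1)] by metis
    then show ?thesis by simp
  next
    case False
    then have "dimension (Suc d) K (Span K (u # Us))"
      using d Cons.prems by (auto intro: Suc_dim)
    then show ?thesis using Cons.prems(2) dimension_is_inj[OF assms(1)] by blast
  qed
  with \<open>d \<le> length Us\<close> show ?case by simp
qed

text \<open>A basis of \<open>V\<close> is an independent list in \<open>W\<close> of full length,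
  hence a basis of \<open>W\<close>.\<close>

lemma dimension_eq_subset:
  assumes "subfield K R" "dimension m K V" "dimension m K W" "V \<subseteq> W"
  shows "V = W"
proof -
  obtain Us where Us: "independent K Us" "length Us = m" "Span K Us = V" "set Us \<subseteq> carrier R"
    using exists_base[OF assms(1,2)] by blast
  then have "set Us \<subseteq> W" using Span_base_incl[OF assms(1) Us(4)] assms(4) by auto
  then show ?thesis
    using independent_length_eq_dimension[OF assms(1,3) Us(1)] Us by simp
qed

end

text \<open>A nonzero \<open>x\<close> in \<open>E\<close> is algebraic over \<open>K\<close>, so
  the ring generated by \<open>x\<close> over \<open>K\<close> is a field; it lies inside
  \<open>E\<close> and contains the inverse of \<open>x\<close>.\<close>

lemma (in field) finite_dimension_subring_imp_subfield:
  assumes "subfield K R" "subring E R" "K \<subseteq> E" "finite_dimension K E"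
  shows "subfield E R"
proof (rule subfieldI'[OF assms(2)])
  fix x assume x: "x \<in> E - {\<zero>}"
  have xc: "x \<in> carrier R" using x subringE(1)[OF assms(2)] by auto
  have "(algebraic over K) x"
    using finite_dimension_imp_algebraic[OF assms(1,2,4)] x by auto
  then have "subfield (simple_extension K x) R"
    using simple_extension_is_subfield[OF assms(1) xc] by simp
  moreover have "x \<in> simple_extension K x"
    using simple_extension_mem[OF subfieldE(1)[OF assms(1)] xc] .
  ultimately have "inv x \<in> simple_extension K x"
    using subfield_m_inv(1) x by blast
  then show "inv x \<in> E"
    using simple_extension_subring_incl[OF assms(2,3)] x by auto
qed

text \<open>The field analogue of \<open>prime_index_powers\<close>. With \<open>m\<close> the
  degree of \<open>E(\<theta>)\<close> over \<open>E\<close> and \<open>q\<close> that of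
  \<open>E'\<close> over \<open>E(\<theta>)\<close>, the tower law gives \<open>m * q = p\<close>.
  As \<open>\<theta>\<close> lies outside \<open>E\<close>, \<open>m\<close> is not 1, so
  \<open>m = p\<close> and \<open>q = 1\<close>.\<close>

lemma (in field) prime_degree_simple_extension:
  assumes K: "subfield K R" and E: "subfield E R" and E': "subfield E' R" and "K \<subseteq> E" "E \<subseteq> E'"
    and d: "dimension d K E" and d': "dimension (p * d) K E'"
    and p: "Factorial_Ring.prime (p :: nat)" and \<theta>: "\<theta> \<in> E'" "\<theta> \<notin> E"
  shows "E' = Span E (exp_base \<theta> p)"
proof -
  note subring = subfieldE(1)[OF E] subfieldE(1)[OF E']
  have \<theta>c: "\<theta> \<in> carrier R" using \<theta> subringE(1)[OF subring(2)] by auto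
  have subalg: "subalgebra W E' R" if "W \<subseteq> E'" for W
    using subring.axioms(1)[OF subring(2)] subringE(6)[OF subring(2)] that
    by (auto simp: subalgebra_def subalgebra_axioms_def)
  have "finite_dimension E E'"
    using finite_dimension_overfield[OF K E] assms subalg finite_dimensionI by blast
  then have alg: "(algebraic over E) \<theta>"
    using finite_dimension_imp_algebraic[OF E subring(2)] \<theta> by blast
  define V where "V = simple_extension E \<theta>"
  have V: "subfield V R" using simple_extension_is_subfield[OF E \<theta>c] alg by (simp add: V_def)
  have EV: "E \<subseteq> V" using simple_extension_incl[OF subringE(1)[OF subring(1)] \<theta>c] by (simp add: V_def)
  have VE': "V \<subseteq> E'"
    using simple_extension_subring_incl[OF subring(2) \<open>E \<subseteq> E'\<close> \<theta>(1)] by (simp add: V_def)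
  define m where "m = degree (Irr E \<theta>)"
  have m: "dimension m E V" using dimension_simple_extension[OF E \<theta>c alg] by (simp add: m_def V_def)
  obtain q where q: "dimension q V E'"
    using finite_dimension_overfield[OF K V _ finite_dimensionI[OF d'] subalg[OF VE']] EV \<open>K \<subseteq> E\<close> by blast
  have "dimension (d * m * q) K E'"
    using telescopic_base[OF K V telescopic_base[OF K E d m] q] .
  then have "d * m * q = p * d" using dimension_is_inj[OF K d'] by simp
  \<comment> \<open>Allows \<open>d\<close> to be cancelled from the degree equation.\<close>
  moreover have "d \<noteq> 0"
  proof
    assume "d = 0"
    then have "E = {\<zero>}" using d dimension_zero[OF K] by simp
    then show False using subringE(3)[OF subring(1)] by simp
  qed
  ultimately have mq: "m * q = p" by simp
  moreover have "m \<noteq> 1"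
  proof
    assume "m = 1"
    then have "E = V" using dimension_eq_subset[OF E dimension_one[OF E] _ EV] m by simp
    then show False using simple_extension_mem[OF subring(1) \<theta>c] \<theta> by (simp add: V_def)
  qed
  ultimately have "m = p" using p by (metis dvd_triv_left prime_nat_iff)
  with mq p have "q = 1" by (metis mult.right_neutral mult_cancel1 not_prime_0)
  then have "V = E'" using dimension_eq_subset[OF V dimension_one[OF V] _ VE'] q by simp
  then show ?thesis
    using Span_exp_base[OF E \<theta>c alg] \<open>m = p\<close> by (simp add: V_def m_def)
qed

text \<open>Each member is a \<open>K\<close>-subspace, so it contains the span of a set as soon as
  it contains the set. The span thus disappears from the flag type, and the field case takes the
  form that \<open>flag_below_tower\<close> asks for.\<close>

lemma field_flag_basics:
  fixes L :: "('a, 'm) ring_scheme" (structure)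
  assumes L: "field L" and K: "subfield K L" and F: "field_flag n L K F"
  shows "i < n \<Longrightarrow> subalgebra K (F i) L"
    and "i < n \<Longrightarrow> j < n \<Longrightarrow> field_flag_type n L K F i j < n"
    and "i < n \<Longrightarrow> j < n \<Longrightarrow> k < n \<Longrightarrow>
      field_flag_type n L K F i j \<le> k \<longleftrightarrow> F i <#> F j \<subseteq> F k"
proof -
  interpret field L by fact
  have chain: "\<forall>i. i + 1 < n \<longrightarrow> F i \<subseteq> F (i + 1)" and top: "F (n - 1) = carrier L"
    and dim: "\<And>i. i < n \<Longrightarrow> dimension (i + 1) K (F i)"
    using F by (auto simp: field_flag_def)
  show alg: "subalgebra K (F i) L" if "i < n" for i
    using finite_dimension_imp_subalgebra[OF K finite_dimensionI[OF dim[OF that]]] .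
  have FL: "F i \<subseteq> carrier L" if "i < n" for i
    using subalgebra_in_carrier[OF alg[OF that]] .
  have prod: "F i <#> F j \<subseteq> carrier L" if "i < n" "j < n" for i j
    using FL[OF that(1)] FL[OF that(2)] by (auto simp: set_mult_def)
  have span_iff: "span_of L K S \<subseteq> F k \<longleftrightarrow> S \<subseteq> F k" if "S \<subseteq> carrier L" "k < n" for S k
  proof
    assume *: "span_of L K S \<subseteq> F k"
    show "S \<subseteq> F k"
    proof
      fix x assume "x \<in> S"
      then have "x \<in> Span K [x]" "set [x] \<subseteq> S" using Span_base_incl[OF K, of "[x]"] that by auto
      then have "x \<in> span_of L K S" unfolding span_of_def by blast
      then show "x \<in> F k" using * by auto
    qed
  next
    assume "S \<subseteq> F k"
    then show "span_of L K S \<subseteq> F k"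
      using subalgebra_Span_incl[OF K alg[OF that(2)]] by (force simp: span_of_def)
  qed
  show le_iff: "field_flag_type n L K F i j \<le> k \<longleftrightarrow> F i <#> F j \<subseteq> F k"
    if "i < n" "j < n" "k < n" for i j k
  proof -
    have "span_of L K (F i <#> F j) \<subseteq> F (n - 1)"
      using span_iff[OF prod[OF that(1,2)], of "n - 1"] prod[OF that(1,2)] top that by simp
    then show ?thesis
      unfolding field_flag_type_def
      using Least_chain_le_iff[OF chain _ that(3)] span_iff[OF prod[OF that(1,2)] that(3)] by blast
  qed
  show "field_flag_type n L K F i j < n" if "i < n" "j < n" for i j
    using le_iff[OF that, of "n - 1"] prod[OF that] top that by simp
qed

text \<open>Dimension replaces cardinality: the \<open>n\<close> vectors \<open>w_i\<close> span a
  space of dimension \<open>n\<close>, so none of them can be dispensed with.\<close>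

lemma tower_le_field_flag_type:
  fixes L :: "('a, 'm) ring_scheme" (structure)
  assumes L: "field L" and K: "subfield K L"
    and F: "field_flag n L K F" and ns: "prime_tower ns" and n: "n = prod_list ns"
    and le: "flag_type_le n (field_flag_type n L K F) (tower_flag_type ns)"
  shows "flag_type_le n (tower_flag_type ns) (field_flag_type n L K F)"
proof -
  interpret field L by fact
  have ns1: "\<forall>m\<in>set ns. 1 < m" using ns prime_gt_1_nat by (auto simp: prime_tower_def)
  have chain: "\<forall>i. i + 1 < n \<longrightarrow> F i \<subseteq> F (i + 1)" and top: "F (n - 1) = carrier L"
    and dim: "\<And>i. i < n \<Longrightarrow> dimension (i + 1) K (F i)" and bot: "F 0 = K"
    using F by (auto simp: field_flag_def)
  note alg = field_flag_basics(1)[OF L K F]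
  note T_less = field_flag_basics(2)[OF L K F]
  have mono: "F i \<subseteq> F j" if "i \<le> j" "j < n" for i j
    using chain_mono[OF chain] that by blast
  have one: "\<one> \<in> K" using subringE(3)[OF subfieldE(1)[OF K]] .
  have mult_T: "x \<otimes> y \<in> F (field_flag_type n L K F i j)"
    if "i < n" "j < n" "x \<in> F i" "y \<in> F j" for i j x y
    using field_flag_basics(3)[OF L K F that(1,2) T_less[OF that(1,2)]] that(3,4)
    by (auto simp: set_mult_def)
  interpret F: flag_below_tower L n ns F
  proof
    fix i j k x y assume *: "i < n" "j < n" "k < n" "tower_flag_type ns i j \<le> k" "x \<in> F i" "y \<in> F j"
    then have "field_flag_type n L K F i j \<le> k" using le by (force simp: flag_type_le_def)
    with mult_T[OF *(1,2,5,6)] mono *(3) show "x \<otimes> y \<in> F k" by blast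
  next
    fix i assume "i < n" then show "F i \<subseteq> carrier L" using mono[of i "n - 1"] top by auto
  qed (use ns1 n bot one mono in auto)
  let ?N = "\<lambda>s. prod_list (take s ns)"
  have pos: "0 < ?N s" for s by (rule prod_list_take_pos[OF F.zero_notin])
  have dimN: "dimension (?N s) K (F (?N s - 1))" for s
    using dim[OF F.block_less[of s]] pos[of s] by simp
  have "\<exists>t. t \<in> F (?N s) \<and> t \<notin> F (?N s - 1)" if "s < length ns" for s
  proof (rule ccontr)
    assume "\<nexists>t. t \<in> F (?N s) \<and> t \<notin> F (?N s - 1)"
    then have "F (?N s) = F (?N s - 1)" using mono[of "?N s - 1" "?N s"] F.block_size_less[OF that] by auto
    then show False
      using dimension_is_inj[OF K dimN[of s], of "?N s + 1"] dim[OF F.block_size_less[OF that]] by simp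
  qed
  then obtain \<theta> where \<theta>: "\<And>s. s < length ns \<Longrightarrow> \<theta> s \<in> F (?N s)"
    and \<theta>': "\<And>s. s < length ns \<Longrightarrow> \<theta> s \<notin> F (?N s - 1)" by metis
  have KF: "K \<subseteq> F i" if "i < n" for i using bot mono[of 0 i] that by auto
  have sub: "subfield (F (?N s - 1)) L" for s
  proof (rule finite_dimension_subring_imp_subfield[OF K _ KF[OF F.block_less] finite_dimensionI[OF dimN]])
    note * = space_subgroup_props[OF K dimN[of s]]
    show "subring (F (?N s - 1)) L"
      using *(1,3,4) KF[OF F.block_less[of s]] one F.block_mult_closed by (intro subringI) auto
  qed
  define w where "w = digit_prod L ns \<theta>"
  have w: "w i \<in> carrier L" for i
    using digit_prod_closed F.gens_closed[OF \<theta>] by (simp add: w_def)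
  then have ws: "set (map w xs) \<subseteq> carrier L" for xs by auto
  \<comment> \<open>Climbing the tower of subfields: the next stage is spanned over the present one
    by the powers of \<open>\<theta> s\<close> below \<open>ns ! s\<close>.\<close>
  have spans: "F (?N s - 1) \<subseteq> Span K (map w [0..<?N s])" if "s \<le> length ns" for s
    using that
  proof (induction s)
    case 0
    \<comment> \<open>\<open>F 0 = K\<close> is spanned over \<open>K\<close> by
      \<open>w 0 = \<one>\<close>.\<close>
    have "w 0 = \<one>" using F.gens_closed[OF \<theta>] by (simp add: w_def digit_prod_0)
    then have "K <#> set [\<one>] \<subseteq> Span K (map w [0..<?N 0])" using Span_incl[OF K, of "[\<one>]"] by simp
    moreover have "K \<subseteq> K <#> set [\<one>]"
      using subringE(1)[OF subfieldE(1)[OF K]] by (force simp: set_mult_def)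
    ultimately show ?case using bot by simp
  next
    case (Suc s)
    then have s: "s < length ns" by simp
    have N: "?N (Suc s) = ns ! s * ?N s" using s by (simp add: take_Suc_conv_app_nth)
    have p: "Factorial_Ring.prime (ns ! s)" using ns s by (simp add: prime_tower_def)
    then have NN: "?N s < ?N (Suc s)" using N pos[of s] prime_gt_1_nat by simp
    have \<theta>s: "\<theta> s \<in> F (?N (Suc s) - 1)"
    proof -
      have "?N s \<le> ?N (Suc s) - 1" using NN by linarith
      then show ?thesis using \<theta>[OF s] mono[OF _ F.block_less] by blast
    qed
    have incl: "F (?N s - 1) \<subseteq> F (?N (Suc s) - 1)"
      by (rule mono[OF _ F.block_less]) (use NN in simp)
    have \<theta>c: "\<theta> s \<in> carrier L" using F.gens_closed[OF \<theta> s] .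
    let ?E = "F (?N s - 1)" and ?W = "Span K (map w [0..<?N (Suc s)])"
    have degree: "dimension (ns ! s * ?N s) K (F (?N (Suc s) - 1))" by (metis N dimN)
    have eq: "F (?N (Suc s) - 1) = Span ?E (exp_base (\<theta> s) (ns ! s))"
      using prime_degree_simple_extension[OF K sub[of s] sub[of "Suc s"] KF[OF F.block_less] incl
          dimN degree p \<theta>s \<theta>'[OF s]] .
    have exp: "set (exp_base (\<theta> s) (ns ! s)) = (\<lambda>a. \<theta> s [^] a) ` {..<ns ! s}"
      by (auto simp: exp_base_def)
    have mem: "e \<otimes> \<theta> s [^] a \<in> ?W" if a: "a < ns ! s" and e: "e \<in> ?E" for a e
    proof -
      \<comment> \<open>For fixed \<open>a\<close> the elements that the power \<open>a\<close> of
        \<open>\<theta> s\<close> carries into \<open>?W\<close> form a \<open>K\<close>-subspace.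
        It contains \<open>w i\<close> for \<open>i < ?N s\<close>, since the product is
        \<open>w (i + ?N s * a)\<close>, and therefore all of \<open>?E\<close>.\<close>
      let ?Z = "{z \<in> carrier L. z \<otimes> \<theta> s [^] a \<in> ?W}"
      have W: "subalgebra K ?W L" using Span_is_subalgebra[OF K ws] .
      have "subalgebra K ?Z L"
      proof (intro subalgebra.intro subalgebra_axioms.intro)
        show "subgroup ?Z (add_monoid L)"
        proof (rule add.subgroupI)
          show "?Z \<noteq> {}" using \<theta>c Span_subgroup_props(2)[OF K ws] by (auto intro!: exI[of _ \<zero>])
        qed (use \<theta>c Span_subgroup_props[OF K ws] in \<open>auto simp: l_distr l_minus a_inv_def[symmetric]\<close>)
        show "k \<otimes> v \<in> ?Z" if "k \<in> K" "v \<in> ?Z" for k v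
          using that \<theta>c Span_smult_closed[OF K ws] subringE(1)[OF subfieldE(1)[OF K]]
          by (auto simp: m_assoc subset_eq)
      qed
      moreover have "set (map w [0..<?N s]) \<subseteq> ?Z"
      proof -
        have "w i \<otimes> \<theta> s [^] a \<in> ?W" if i: "i < ?N s" for i
        proof -
          have "w i \<otimes> \<theta> s [^] a = w (i + ?N s * a)"
            using i a s F.gens_closed[OF \<theta>] by (simp add: w_def digit_prod_block F.zero_notin)
          moreover have "i + ?N s * a < ?N (Suc s)"
            unfolding N using mod_plus_mult_less[OF i a] by (simp add: mult.commute)
          ultimately have "w i \<otimes> \<theta> s [^] a \<in> set (map w [0..<?N (Suc s)])" by simp
          then show ?thesis using Span_base_incl[OF K ws] by blast
        qed
        then show ?thesis using w by auto
      qed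
      ultimately have "Span K (map w [0..<?N s]) \<subseteq> ?Z" by (rule subalgebra_Span_incl[OF K])
      then show ?thesis using Suc.IH s e by auto
    qed
    show ?case
      unfolding eq
    proof (rule Span_min[OF sub])
      show "set (exp_base (\<theta> s) (ns ! s)) \<subseteq> carrier L" using \<theta>c exp by auto
      show "subgroup ?W (add_monoid L)" using Span_is_add_subgroup[OF K ws] .
      show "?E <#> set (exp_base (\<theta> s) (ns ! s)) \<subseteq> ?W" using mem by (auto simp: exp set_mult_def)
    qed
  qed
  have full: "carrier L \<subseteq> Span K (map w [0..<n])" using spans[of "length ns"] top n by simp
  have indep: "i \<le> k" if ik: "i < n" "k < n" "digit_prod L ns \<theta> i \<in> F k" for i k
  proof (rule ccontr)
    assume "\<not> i \<le> k"
    then have i: "k \<le> i - 1" "i - 1 < n" "dimension i K (F (i - 1))" using ik dim[of "i - 1"] by auto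
    obtain Bs where Bs: "set Bs \<subseteq> carrier L" "length Bs = i" "Span K Bs = F (i - 1)"
      using exists_base[OF K i(3)] by blast
    \<comment> \<open>Replace \<open>w 0, ..., w i\<close>, which would all lie in
      \<open>F (i - 1)\<close>, by a basis of that member. This saves one vector:
      \<open>n - 1\<close> vectors would span a space of dimension \<open>n\<close>.\<close>
    define Us where "Us = Bs @ map w [Suc i..<n]"
    have Us: "set Us \<subseteq> carrier L" using Bs w by (auto simp: Us_def)
    have "w j \<in> Span K Us" if "j < n" for j
    proof (cases "j \<le> i")
      case True
      have "w j \<in> F (i - 1)"
      proof (cases "j = i")
        case True
        then show ?thesis using ik(3) mono[OF i(1,2)] by (auto simp: w_def)
      next
        case False
        then have "j \<le> i - 1" using \<open>j \<le> i\<close> by simp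
        then show ?thesis using F.digit_prod_mem[OF \<theta> that] mono[OF _ i(2)] by (auto simp: w_def)
      qed
      then show ?thesis using Bs mono_Span_append(1)[OF K Bs(1) ws] by (auto simp: Us_def)
    next
      case False
      then have "w j \<in> set Us" using that by (auto simp: Us_def)
      then show ?thesis using Span_base_incl[OF K Us] by blast
    qed
    then have "Span K (map w [0..<n]) \<subseteq> Span K Us"
      by (intro mono_Span_subset[OF K _ Us]) auto
    then have "Span K Us = carrier L"
      using full Span_in_carrier[OF subringE(1)[OF subfieldE(1)[OF K]] Us] by auto
    then have "dimension n K (Span K Us)" using dim[of "n - 1"] top ik by simp
    then have "n \<le> length Us" using dimension_Span_le[OF K Us] by simp
    then show False using Bs ik by (simp add: Us_def)
  qed
  have "tower_flag_type ns i j \<le> field_flag_type n L K F i j" if "i < n" "j < n" for i j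
    using F.tower_flag_type_le[of \<theta> "field_flag_type n L K F", OF \<theta> indep T_less mult_T that] by blast
  then show ?thesis by (simp add: flag_type_le_def)
qed

section \<open>Splitting a composite entry\<close>

text \<open>Multiplying by \<open>prod_list us\<close> shifts all digits past the places of
  \<open>us\<close>, where only zeros remain.\<close>

lemma no_carry_append_mult:
  assumes "0 \<notin> set us"
  shows "no_carry (us @ ms) (prod_list us * x) (prod_list us * y) \<longleftrightarrow> no_carry ms x y"
  using assms by (induction us) (auto simp: mult.assoc)

text \<open>By \<open>no_carry_refine\<close> the split creates no new carry-free pairs, which gives
  the inequality. It is strict at a pair whose sum is carry-free in base \<open>a * b\<close> but
  carries once \<open>a\<close> is a radix of its own.\<close>

lemma tower_flag_type_refine:
  assumes ns: "\<forall>m\<in>set (us @ a # b # vs). 1 < m" and n: "n = prod_list (us @ a * b # vs)"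
  shows "flag_type_le n (tower_flag_type (us @ a # b # vs)) (tower_flag_type (us @ a * b # vs))"
    and "\<not> flag_type_eq n (tower_flag_type (us @ a # b # vs)) (tower_flag_type (us @ a * b # vs))"
proof -
  let ?ns = "us @ a * b # vs" and ?ns' = "us @ a # b # vs" and ?N = "prod_list us"
  have ab: "1 < a" "1 < b" using ns by auto
  then have "1 < a * b" by (simp add: one_less_mult)
  then have ns1: "\<forall>m\<in>set ?ns. 1 < m" using ns by auto
  have n': "n = prod_list ?ns'" using n by (simp add: mult.assoc)
  note le_iff = tower_flag_type_le_iff[OF ns1 n] and le_iff' = tower_flag_type_le_iff[OF ns n']
  note less = tower_flag_type_less[OF ns1 n]
  have refine: "no_carry ?ns i j" if "no_carry ?ns' i j" for i j
    using no_carry_refine[OF _ _ that] ab by simp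
  have "tower_flag_type ?ns' i j \<le> tower_flag_type ?ns i j" if "i < n" "j < n" for i j
    using le_iff[OF that less[OF that]] refine by (subst le_iff') (auto simp: that less)
  then show "flag_type_le n (tower_flag_type ?ns') (tower_flag_type ?ns)"
    by (simp add: flag_type_le_def)
  have 0: "0 \<notin> set us" "0 \<notin> set vs" using ns by auto
  have N: "0 < ?N" "0 < prod_list vs" using 0 prod_list_pos by auto
  \<comment> \<open>In base \<open>a * b\<close> the digits \<open>a - 1\<close> and 1 at the split
    place add up to \<open>a\<close> without a carry, since \<open>b > 1\<close>. After the split
    both indices lie below the partial product \<open>?N * a\<close>, so carry-free sums stay below
    it too.\<close>
  let ?i = "?N * (a - 1)" and ?j = "?N * 1"
  have sum: "?i + ?j = ?N * a"
    using ab by (metis add_mult_distrib2 le_add_diff_inverse2 less_imp_le)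
  have "?N * a < ?N * a * b" using ab N by simp
  also have "\<dots> \<le> n" using n N by simp
  finally have less_n: "?N * a < n" .
  then have ij: "?i < n" "?j < n" "?N * a - 1 < n" using sum by linarith+
  have "no_carry (a * b # vs) (a - 1) 1"
  proof -
    have "a < a * b" using ab by simp
    then have "a - 1 < a * b" by linarith
    then have "(a - 1) mod (a * b) = a - 1" by (rule mod_less)
    with \<open>a < a * b\<close> show ?thesis using ab \<open>1 < a * b\<close> 0 by (simp add: no_carry_0_right)
  qed
  then have "no_carry ?ns ?i ?j"
    using no_carry_append_mult[OF 0(1), of "a * b # vs" "a - 1" 1] by blast
  then have "?i + ?j \<le> tower_flag_type ?ns ?i ?j"
    using le_iff[OF ij(1,2) less[OF ij(1,2)]] by blast
  then have "?N * a \<le> tower_flag_type ?ns ?i ?j" unfolding sum .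
  moreover have "tower_flag_type ?ns' ?i ?j \<le> ?N * a - 1"
    unfolding le_iff'[OF ij]
  proof (intro allI impI)
    fix i j assume *: "i \<le> ?i" "j \<le> ?j" "no_carry ?ns' i j"
    have "?i < ?N * a" "?j < ?N * a" using N ab by auto
    then have "i < ?N * a" "j < ?N * a" using *(1,2) by (blast intro: le_less_trans)+
    then have "i + j < prod_list (us @ [a])"
      using *(3) by (intro no_carry_imp_less[of "us @ [a]" "b # vs"]) auto
    then show "i + j \<le> ?N * a - 1" by simp
  qed
  moreover have "0 < ?N * a" using N ab by simp
  ultimately have "tower_flag_type ?ns' ?i ?j < tower_flag_type ?ns ?i ?j" by linarith
  then show "\<not> flag_type_eq n (tower_flag_type ?ns') (tower_flag_type ?ns)"
    unfolding flag_type_eq_def using ij by (metis less_irrefl)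
qed

section \<open>From the two kinds of flags to the minimality criterion\<close>

lemma prime_tower_le_realizable:
  assumes ns: "prime_tower ns" and n: "n = prod_list ns"
    and T: "realizable TYPE('u::infinite) n T" and le: "flag_type_le n T (tower_flag_type ns)"
  shows "flag_type_le n (tower_flag_type ns) T"
proof -
  have step: "flag_type_le n (tower_flag_type ns) T"
    if "flag_type_eq n T S" "flag_type_le n S (tower_flag_type ns) \<Longrightarrow> flag_type_le n (tower_flag_type ns) S"
    for S
    using that le by (simp add: flag_type_eq_def flag_type_le_def)
  from T consider
      (group) G :: "'u monoid" and F where "comm_group G" "finite (carrier G)" "order G = n"
        "group_flag n G F" "flag_type_eq n T (group_flag_type n G F)"
    | (field) L :: "'u ring" and K F where "field L" "subfield K L" "field_flag n L K F"
        "flag_type_eq n T (field_flag_type n L K F)"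
    unfolding realizable_def group_realizable_def field_realizable_def by blast
  then show ?thesis
  proof cases
    case group
    show ?thesis
      by (rule step[OF group(5)]) (rule tower_le_group_flag_type[OF group(1-4) ns n])
  next
    case field
    show ?thesis
      by (rule step[OF field(4)]) (rule tower_le_field_flag_type[OF field(1-3) ns n])
  qed
qed

theorem theorem1p12:
  fixes n :: nat and ns :: "nat list"
  assumes "tower_type n ns"
  shows "minimal_flag_type TYPE('u::infinite) n (tower_flag_type ns) \<longleftrightarrow> prime_tower ns"
proof -
  have ns: "\<forall>m\<in>set ns. 1 < m" and n: "n = prod_list ns"
    using assms by (auto simp: tower_type_def)
  show ?thesis
  proof
    assume prime: "prime_tower ns"
    have "flag_type_eq n T (tower_flag_type ns)"
      if "realizable TYPE('u) n T" "flag_type_le n T (tower_flag_type ns)" for T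
      using prime_tower_le_realizable[OF prime n that] that(2)
      by (simp add: flag_type_le_def flag_type_eq_def antisym)
    then show "minimal_flag_type TYPE('u) n (tower_flag_type ns)"
      unfolding minimal_flag_type_def using tower_realizable[OF ns n] by blast
  next
    assume min: "minimal_flag_type TYPE('u) n (tower_flag_type ns)"
    show "prime_tower ns"
    proof (rule ccontr)
      assume "\<not> prime_tower ns"
      then obtain m where m: "m \<in> set ns" "\<not> Factorial_Ring.prime m" by (auto simp: prime_tower_def)
      then obtain a b where ab: "m = a * b" "1 < a" "1 < b"
      proof -
        have "1 < m" using ns m by blast
        with m(2) obtain d where d: "d dvd m" "d \<noteq> 1" "d \<noteq> m" by (auto simp: prime_nat_iff)
        then obtain k where k: "m = d * k" by blast
        then have "d \<noteq> 0" "k \<noteq> 0" "k \<noteq> 1"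
          using d \<open>1 < m\<close> by (metis mult_0 not_less_zero, metis mult_0_right not_less_zero, simp)
        then show ?thesis using that[of d k] k d(2) by simp
      qed
      obtain us vs where "ns = us @ m # vs" using split_list[OF m(1)] by blast
      then have split: "ns = us @ a * b # vs" by (simp add: ab)
      \<comment> \<open>The split tower has the same degree, is realizable and lies strictly below,
        against minimality.\<close>
      define ns' where "ns' = us @ a # b # vs"
      have ns': "\<forall>m\<in>set ns'. 1 < m" "n = prod_list ns'"
        using ns n ab by (auto simp: ns'_def split mult.assoc)
      note refine = tower_flag_type_refine[OF ns'(1)[unfolded ns'_def] n[unfolded split],
          folded ns'_def split]
      show False
        using min tower_realizable[OF ns'] refine unfolding minimal_flag_type_def by blast
    qed
  qed
qed

end
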